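(* Let $\mathcal{X}\subset\mathbb{R}^n$ be a locally compact set, $f:\mathcal{X}\to\mathbb{R}^n$ a locally bounded vector field and $g$ a locally weakly bounded metric on $\mathcal{X}$. Then, for any $x_0\in\mathcal{X}$ there exists a Krasovskii solution $x:[0,T)\to\mathcal{X}$, for some $T>0$, of $$\dot x\in\Pi_{\mathcal{X}}^{g}[f](x),\qquad x(0)=x_0 .$$ In addition, for $r>0$ such that $U_r:=\{x\in\mathcal{X}\mid \|x-x_0\|\le r\}$ is closed and $L=\max_{y\in U_r}\|\mathrm{K}[\Pi_{\mathcal{X}}^{g}[f]](y)\|$ exists, the solution is (locally) Lipschitz and exists for $T>r/L$.
   Context: $\|\cdot\|$ is the Euclidean norm; for a set $A\subset\mathbb{R}^n$, $\|A\|:=\sup_{v\in A}\|v\|$. A set is locally compact if it is the intersection of a closed and an open subset of $\mathbb{R}^n$. Neighborhoods of points of $\mathcal{X}$ are relative to $\mathcal{X}$. A map $f$ on $\mathcal{X}$ is locally bounded if for every $x\in\mathcal{X}$ there is $M>0$ with $\|f(y)\|\le M$ for all $y\in\mathcal{X}$ in a neighborhood of $x$. Tangent cone: for $x\in\mathcal{X}$, $T_x\mathcal{X}$ is the set of all $v\in\mathbb{R}^n$ for which there exist $x_k\in\mathcal{X}$, $x_k\to x$, and $\delta_k\to 0^+$ with $(x_k-x)/\delta_k\to v$. Metric: a map $g$ assigning to every $x\in\mathcal{X}$ an inner product $\langle\cdot,\cdot\rangle_{g(x)}$ on $\mathbb{R}^n$, with norm $\|\cdot\|_{g(x)}$. Put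 $\lambda^{\max}_{g(x)}=\max\{\|v\|_{g(x)}:\|v\|=1\}$, $\lambda^{\min}_{g(x)}=\min\{\|v\|_{g(x)}:\|v\|=1\}$, $\kappa_{g(x)}=\lambda^{\max}_{g(x)}/\lambda^{\min}_{g(x)}$. The metric is locally weakly bounded if for every $x\in\mathcal{X}$ there are $\ell,L'>0$ with $\ell\le\kappa_{g(y)}\le L'$ for all $y\in\mathcal{X}$ in a neighborhood of $x$. Projected vector field (set-valued): $\Pi_{\mathcal{X}}^{g}[f](x):=\arg\min_{v\in T_x\mathcal{X}}\|v-f(x)\|^2_{g(x)}$. Krasovskii regularization of a set-valued map $F:\mathcal{X}\rightrightarrows\mathbb{R}^n$: $\mathrm{K}[F](x)$ is the closed convex hull of $\limsup_{y\to x}F(y)$, where $\limsup_{y\to x}F(y)$ is the set of all $v$ for which there are $x_k\in\mathcal{X}$, $x_k\to x$, and $v_k\in F(x_k)$ with $v_k\to v$. A Krasovskii solution of $\dot x\in F(x)$, $x(0)=x_0$, is an absolutely continuous $x:[0,T)\to\mathcal{X}$ with $T>0$, $x(0)=x_0$ and $\dot x(t)\in\mathrm{K}[F](x(t))$ for almost all $t$. *)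

theory Defs
  imports "HOL-Analysis.Analysis"
begin

text \<open>
  Maps on a set X (vector fields, metrics, set-valued maps) are total functions whose values
  outside X never enter.
\<close>

text \<open>Equivalent to the library's \<^term>\<open>locally compact X\<close> by
  \<open>locally_compact_closed_Int_open\<close>.\<close>
definition locally_compact_set :: "'a::euclidean_space set \<Rightarrow> bool" where
  "locally_compact_set X \<longleftrightarrow> (\<exists>C U. closed C \<and> open U \<and> X = C \<inter> U)"

definition locally_bounded_on :: "'a::euclidean_space set \<Rightarrow> ('a \<Rightarrow> 'a) \<Rightarrow> bool" where
  "locally_bounded_on X f \<longleftrightarrow>
     (\<forall>x\<in>X. \<exists>M>0. \<exists>e>0. \<forall>y\<in>X \<inter> ball x e. norm (f y) \<le> M)"

definition tangent_cone :: "'a::euclidean_space set \<Rightarrow> 'a \<Rightarrow> 'a set" where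
  "tangent_cone X x =
     {v. \<exists>(xs :: nat \<Rightarrow> 'a) (\<delta> :: nat \<Rightarrow> real).
           (\<forall>k. xs k \<in> X) \<and> xs \<longlonglongrightarrow> x \<and>
           (\<forall>k. \<delta> k > 0) \<and> \<delta> \<longlonglongrightarrow> 0 \<and>
           (\<lambda>k. (xs k - x) /\<^sub>R \<delta> k) \<longlonglongrightarrow> v}"

definition is_inner_product :: "('a::euclidean_space \<Rightarrow> 'a \<Rightarrow> real) \<Rightarrow> bool" where
  "is_inner_product B \<longleftrightarrow>
     bilinear B \<and> (\<forall>u v. B u v = B v u) \<and> (\<forall>v. v \<noteq> 0 \<longrightarrow> B v v > 0)"

definition metric_on :: "'a::euclidean_space set \<Rightarrow> ('a \<Rightarrow> 'a \<Rightarrow> 'a \<Rightarrow> real) \<Rightarrow> bool" where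
  "metric_on X g \<longleftrightarrow> (\<forall>x\<in>X. is_inner_product (g x))"

definition ip_norm :: "('a::euclidean_space \<Rightarrow> 'a \<Rightarrow> real) \<Rightarrow> 'a \<Rightarrow> real" where
  "ip_norm B v = sqrt (B v v)"

definition lambda_max :: "('a::euclidean_space \<Rightarrow> 'a \<Rightarrow> real) \<Rightarrow> real" where
  "lambda_max B = (GREATEST m. m \<in> ip_norm B ` {v. norm v = 1})"

definition lambda_min :: "('a::euclidean_space \<Rightarrow> 'a \<Rightarrow> real) \<Rightarrow> real" where
  "lambda_min B = (LEAST m. m \<in> ip_norm B ` {v. norm v = 1})"

definition condition_number :: "('a::euclidean_space \<Rightarrow> 'a \<Rightarrow> real) \<Rightarrow> real" where
  "condition_number B = lambda_max B / lambda_min B"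

definition locally_weakly_bounded ::
  "'a::euclidean_space set \<Rightarrow> ('a \<Rightarrow> 'a \<Rightarrow> 'a \<Rightarrow> real) \<Rightarrow> bool" where
  "locally_weakly_bounded X g \<longleftrightarrow>
     (\<forall>x\<in>X. \<exists>l>0. \<exists>L'>0. \<exists>e>0. \<forall>y\<in>X \<inter> ball x e.
        l \<le> condition_number (g y) \<and> condition_number (g y) \<le> L')"

definition projected_field ::
  "'a::euclidean_space set \<Rightarrow> ('a \<Rightarrow> 'a \<Rightarrow> 'a \<Rightarrow> real) \<Rightarrow> ('a \<Rightarrow> 'a) \<Rightarrow> 'a \<Rightarrow> 'a set" where
  "projected_field X g f x =
     {v. is_arg_min (\<lambda>v. (ip_norm (g x) (v - f x))\<^sup>2) (\<lambda>v. v \<in> tangent_cone X x) v}"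

definition outer_limit :: "'a::euclidean_space set \<Rightarrow> ('a \<Rightarrow> 'a set) \<Rightarrow> 'a \<Rightarrow> 'a set" where
  "outer_limit X F x =
     {v. \<exists>(xs :: nat \<Rightarrow> 'a) (vs :: nat \<Rightarrow> 'a).
           (\<forall>k. xs k \<in> X) \<and> xs \<longlonglongrightarrow> x \<and>
           (\<forall>k. vs k \<in> F (xs k)) \<and> vs \<longlonglongrightarrow> v}"

definition krasovskii :: "'a::euclidean_space set \<Rightarrow> ('a \<Rightarrow> 'a set) \<Rightarrow> 'a \<Rightarrow> 'a set" where
  "krasovskii X F x = closure (convex hull (outer_limit X F x))"

text \<open>
  Absolute continuity of a curve in the usual epsilon-delta form; D is a finite family of
  intervals, each encoded by its pair of endpoints.
\<close>
definition absolutely_continuous_curve_on ::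
  "real set \<Rightarrow> (real \<Rightarrow> 'a::euclidean_space) \<Rightarrow> bool" where
  "absolutely_continuous_curve_on I x \<longleftrightarrow>
     (\<forall>\<epsilon>>0. \<exists>\<delta>>0. \<forall>D :: (real \<times> real) set.
        finite D \<and> (\<forall>(a, b)\<in>D. a \<le> b \<and> {a..b} \<subseteq> I) \<and>
        pairwise (\<lambda>p q. disjnt {fst p<..<snd p} {fst q<..<snd q}) D \<and>
        (\<Sum>(a, b)\<in>D. b - a) < \<delta>
        \<longrightarrow> (\<Sum>(a, b)\<in>D. norm (x b - x a)) < \<epsilon>)"

text \<open>
  Only the restriction of the curve x to the half-open interval from 0 to T matters, so the same
  total function x can be a solution for several horizons T.
\<close>
definition krasovskii_solution ::
  "'a::euclidean_space set \<Rightarrow> ('a \<Rightarrow> 'a set) \<Rightarrow> 'a \<Rightarrow> real \<Rightarrow> (real \<Rightarrow> 'a) \<Rightarrow> bool" where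
  "krasovskii_solution X F x0 T x \<longleftrightarrow>
     T > 0 \<and> x 0 = x0 \<and> x ` {0..<T} \<subseteq> X \<and>
     absolutely_continuous_curve_on {0..<T} x \<and>
     (AE t\<in>{0..<T} in lebesgue.
        \<exists>v\<in>krasovskii X F (x t). (x has_vector_derivative v) (at t within {0..<T}))"

text \<open>The supremum is taken in the extended reals, so that an unbounded set has norm \<open>\<infinity>\<close>.\<close>
definition set_norm :: "'a::euclidean_space set \<Rightarrow> ereal" where
  "set_norm A = (SUP v\<in>A. ereal (norm v))"

definition is_max_on :: "'a set \<Rightarrow> ('a \<Rightarrow> ereal) \<Rightarrow> real \<Rightarrow> bool" where
  "is_max_on U h L \<longleftrightarrow> (\<exists>y\<in>U. h y = ereal L) \<and> (\<forall>y\<in>U. h y \<le> ereal L)"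

end

theory Submission
  imports Defs "HOL-Complex_Analysis.Great_Picard"
begin

text \<open>
  The projected field has nonempty, locally bounded values inside the tangent cone, and its
  Krasovskii regularization K is upper semicontinuous with compact convex values. Tangency and
  compactness give Euler polygons whose vertices lie in X and whose step sizes are bounded below, and
  a uniform limit of these polygons is a solution. That no information is lost in the limit is seen
  without weak compactness: a curve is called a solution if, for every e > 0, its mean velocities
  over all short intervals around t are e-close to K (x t). By convexity this condition can be
  concatenated and passes to limits, and at points of differentiability it gives the differential
  inclusion. Since Lipschitz curves are differentiable almost everywhere, it remains to choose one
  inextensible solution: as long as it stays in the ball of radius r its speed is at most L, so if
  it lived only up to a time T with L T \<le> r, it would have a limit in the closed set U_r and
  could be continued from there.
\<close>

section \<open>Differentiability of Lipschitz curves\<close>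

text \<open>In the conclusion the curve is quantified before \<open>r\<close> and \<open>L\<close>,
  and solutions are not unique: one curve must serve every admissible radius. This is why a curve
  that cannot be prolonged is fixed first and every lifetime bound is proved about it. The obstacle
  in the construction is that \<open>X\<close> may have empty interior and the field need not be
  continuous: a step along a tangent direction may leave \<open>X\<close>, and how short it has to
  be depends on its starting point. The end of each step is therefore chosen in \<open>X\<close>, at
  the price of a direction that is only close to a field value at some nearby centre; points between
  vertices are compared with the field at such centres, never at the points themselves. The local
  bound on the field comes from \<open>0\<close> being a tangent vector: projecting moves
  \<open>f x\<close> by at most the condition number times its length, whatever the scale of the
  metric.\<close>

lemma emeasure_interval_measure_ball:
  fixes F :: "real \<Rightarrow> real"
  assumes "mono F" "continuous_on UNIV F" "0 < r"
  shows "emeasure (interval_measure F) (ball c r) = ennreal (F (c + r) - F (c - r))"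
proof -
  have F: "\<And>x y. x \<le> y \<Longrightarrow> F x \<le> F y"
    using assms(1) by (simp add: monoD)
  have *: "emeasure (interval_measure F) {a..b} = ennreal (F b - F a)" if "a \<le> b" for a b
    by (rule emeasure_interval_measure_Icc[OF that F assms(2)])
  have null: "{c - r, c + r} \<in> null_sets (interval_measure F)"
  proof -
    have "{a} \<in> null_sets (interval_measure F)" for a
      using *[of a a] by (auto simp: null_sets_def)
    then have "{c - r} \<union> {c + r} \<in> null_sets (interval_measure F)"
      by blast
    then show ?thesis
      by (simp add: insert_commute)
  qed
  have "ball c r = {c - r..c + r} - {c - r, c + r}"
    by (auto simp: ball_eq_greaterThanLessThan)
  then have "emeasure (interval_measure F) (ball c r) = emeasure (interval_measure F) {c - r..c + r}"
    using null by (simp add: emeasure_Diff_null_set)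
  then show ?thesis
    using * assms(3) by simp
qed

lemma emeasure_UN_balls:
  fixes C :: "(real \<times> real) set"
  assumes "countable C" "pairwise (\<lambda>i j. disjnt (ball (fst i) (snd i)) (ball (fst j) (snd j))) C"
    and "sets M = sets borel"
  shows "emeasure M (\<Union>i\<in>C. ball (fst i) (snd i))
     = (\<integral>\<^sup>+i. emeasure M (ball (fst i) (snd i)) \<partial>count_space C)"
proof (rule emeasure_UN_countable)
  show "disjoint_family_on (\<lambda>i. ball (fst i) (snd i)) C"
    using assms(2) by (auto simp: disjoint_family_on_def pairwise_def disjnt_def)
qed (use assms in auto)

text \<open>Asking for \<open>negligible (E - T)\<close> in place of inclusion lets the lemma be
  applied to its own output: the union of one family is the \<open>T\<close> of the next. The balls
  can be kept inside \<open>T\<close> because \<open>P\<close> is available at arbitrarily small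
  radii.\<close>

lemma Vitali_cover_real:
  fixes E T :: "real set"
  assumes "open T" "negligible (E - T)"
    and "\<And>x d. x \<in> E \<Longrightarrow> d > 0 \<Longrightarrow> \<exists>c r. 0 < r \<and> r < d \<and> x \<in> ball c r \<and> P c r"
  obtains C where "countable C" "(\<Union>i\<in>C. ball (fst i) (snd i)) \<subseteq> T"
    "pairwise (\<lambda>i j. disjnt (ball (fst i) (snd i)) (ball (fst j) (snd j))) C"
    "negligible (E - (\<Union>i\<in>C. ball (fst i) (snd i)))"
    "\<And>c r. (c, r) \<in> C \<Longrightarrow> 0 < r \<and> P c r"
proof -
  define K where "K = {(c, r). 0 < r \<and> P c r \<and> ball c r \<subseteq> T}"
  have cov: "\<exists>i. i \<in> K \<and> x \<in> ball (fst i) (snd i) \<and> snd i < d"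
    if x: "x \<in> E \<inter> T" and d: "0 < d" for x d
  proof -
    obtain e where e: "0 < e" "ball x e \<subseteq> T"
      using x assms(1) open_contains_ball by blast
    \<comment> \<open>The ball contains \<open>x\<close> but need not be centred there, so it
      reaches up to \<open>2 * r\<close> from \<open>x\<close>; hence the bound
      \<open>e/2\<close>.\<close>
    obtain c r where cr: "0 < r" "r < min d (e/2)" "x \<in> ball c r" "P c r"
      using assms(3)[of x "min d (e/2)"] x d e by auto
    have "ball c r \<subseteq> ball x e"
      using cr by (auto simp: dist_real_def)
    then show ?thesis
      using cr e by (intro exI[of _ "(c, r)"]) (auto simp: K_def)
  qed
  obtain C where C: "countable C" "C \<subseteq> K"
     "pairwise (\<lambda>i j. disjnt (ball (fst i) (snd i)) (ball (fst j) (snd j))) C"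
     "negligible ((E \<inter> T) - (\<Union>i\<in>C. ball (fst i) (snd i)))"
    by (rule Vitali_covering_theorem_balls[of "E \<inter> T" K fst snd, OF cov]) auto
  show ?thesis
  proof
    have "negligible ((E \<inter> T - (\<Union>i\<in>C. ball (fst i) (snd i))) \<union> (E - T))"
      using C(4) assms(2) by (rule negligible_Un)
    then show "negligible (E - (\<Union>i\<in>C. ball (fst i) (snd i)))"
      by (rule negligible_subset) auto
    show "(\<Union>i\<in>C. ball (fst i) (snd i)) \<subseteq> T"
      using C(2) by (fastforce simp: K_def simp del: mem_ball)
  qed (use C in \<open>auto simp: K_def\<close>)
qed

text \<open>
  Failure of differentiability at x forces one of the countably many gaps p < q: arbitrarily short
  intervals around x with secant slope below p, and others with slope above q. Intervals need not be
  centred at x, so that Vitali's covering theorem applies.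
\<close>
definition small_slope :: "(real \<Rightarrow> real) \<Rightarrow> real \<Rightarrow> real \<Rightarrow> bool" where
  "small_slope F p x \<longleftrightarrow>
     (\<forall>d>0. \<exists>c r. 0 < r \<and> r < d \<and> x \<in> ball c r \<and> F (c + r) - F (c - r) < p * (2 * r))"

definition large_slope :: "(real \<Rightarrow> real) \<Rightarrow> real \<Rightarrow> real \<Rightarrow> bool" where
  "large_slope F q x \<longleftrightarrow>
     (\<forall>d>0. \<exists>c r. 0 < r \<and> r < d \<and> x \<in> ball c r \<and> F (c + r) - F (c - r) > q * (2 * r))"

text \<open>
  With mu the Stieltjes measure of F: cover E inside T by disjoint intervals I of slope < p, then
  inside their union by disjoint intervals J of slope > q; then
  q |U J| \<le> mu (U J) \<le> mu (U I) \<le> p |U I|.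
\<close>
lemma slope_gap_contraction:
  fixes F :: "real \<Rightarrow> real"
  assumes F: "mono F" "continuous_on UNIV F" and pq: "0 \<le> p" "p < q"
    and E: "\<And>x. x \<in> E \<Longrightarrow> small_slope F p x \<and> large_slope F q x"
    and T: "open T" "negligible (E - T)"
  obtains T' where "open T'" "negligible (E - T')"
    "emeasure lborel T' \<le> ennreal (p / q) * emeasure lborel T"
proof -
  let ?\<mu> = "interval_measure F"
  let ?U = "\<lambda>C::(real \<times> real) set. \<Union>i\<in>C. ball (fst i) (snd i)"
  have leb: "emeasure lborel (ball c r) = ennreal (2 * r)" if "0 < r" for c r :: real
    using that by (simp add: ball_eq_greaterThanLessThan)
  obtain C where C: "countable C" "?U C \<subseteq> T"
    "pairwise (\<lambda>i j. disjnt (ball (fst i) (snd i)) (ball (fst j) (snd j))) C"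
    "negligible (E - ?U C)"
    "\<And>c r. (c, r) \<in> C \<Longrightarrow> 0 < r \<and> F (c + r) - F (c - r) < p * (2 * r)"
    by (rule Vitali_cover_real[OF T, of "\<lambda>c r. F (c + r) - F (c - r) < p * (2 * r)"])
      (use E in \<open>auto simp: small_slope_def\<close>)
  have "open (?U C)"
    by auto
  obtain D where D: "countable D" "?U D \<subseteq> ?U C"
    "pairwise (\<lambda>i j. disjnt (ball (fst i) (snd i)) (ball (fst j) (snd j))) D"
    "negligible (E - ?U D)"
    "\<And>c r. (c, r) \<in> D \<Longrightarrow> 0 < r \<and> F (c + r) - F (c - r) > q * (2 * r)"
    by (rule Vitali_cover_real[OF \<open>open (?U C)\<close> C(4), of "\<lambda>c r. F (c + r) - F (c - r) > q * (2 * r)"])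
      (use E in \<open>auto simp: large_slope_def\<close>)
  have "ennreal q * emeasure lborel (?U D)
      = (\<integral>\<^sup>+i. ennreal q * emeasure lborel (ball (fst i) (snd i)) \<partial>count_space D)"
    using D by (simp add: emeasure_UN_balls nn_integral_cmult)
  also have "\<dots> \<le> (\<integral>\<^sup>+i. emeasure ?\<mu> (ball (fst i) (snd i)) \<partial>count_space D)"
  proof (rule nn_integral_mono)
    fix i assume "i \<in> space (count_space D)"
    then have i: "0 < snd i" "F (fst i + snd i) - F (fst i - snd i) > q * (2 * snd i)"
      using D(5)[of "fst i" "snd i"] by auto
    show "ennreal q * emeasure lborel (ball (fst i) (snd i)) \<le> emeasure ?\<mu> (ball (fst i) (snd i))"
      unfolding leb[OF i(1)] emeasure_interval_measure_ball[OF F i(1)]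
      using i pq by (simp add: ennreal_mult[symmetric] ennreal_leI)
  qed
  also have "\<dots> = emeasure ?\<mu> (?U D)"
    using D by (simp add: emeasure_UN_balls)
  also have "\<dots> \<le> emeasure ?\<mu> (?U C)"
    using D(2) \<open>open (?U C)\<close> by (intro emeasure_mono) simp_all
  also have "\<dots> = (\<integral>\<^sup>+i. emeasure ?\<mu> (ball (fst i) (snd i)) \<partial>count_space C)"
    using C by (simp add: emeasure_UN_balls)
  also have "\<dots> \<le> (\<integral>\<^sup>+i. ennreal p * emeasure lborel (ball (fst i) (snd i)) \<partial>count_space C)"
  proof (rule nn_integral_mono)
    fix i assume "i \<in> space (count_space C)"
    then have i: "0 < snd i" "F (fst i + snd i) - F (fst i - snd i) < p * (2 * snd i)"
      using C(5)[of "fst i" "snd i"] by auto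
    show "emeasure ?\<mu> (ball (fst i) (snd i)) \<le> ennreal p * emeasure lborel (ball (fst i) (snd i))"
      unfolding leb[OF i(1)] emeasure_interval_measure_ball[OF F i(1)]
      using i pq by (simp add: ennreal_mult[symmetric] ennreal_leI)
  qed
  also have "\<dots> = ennreal p * emeasure lborel (?U C)"
    using C by (simp add: emeasure_UN_balls nn_integral_cmult)
  also have "\<dots> \<le> ennreal p * emeasure lborel T"
    using C(2) T(1) by (intro mult_left_mono emeasure_mono) auto
  finally have le: "ennreal q * emeasure lborel (?U D) \<le> ennreal p * emeasure lborel T" .
  have "emeasure lborel (?U D) = ennreal (1 / q) * (ennreal q * emeasure lborel (?U D))"
    using pq by (simp add: mult.assoc[symmetric] ennreal_mult[symmetric])
  also have "\<dots> \<le> ennreal (1 / q) * (ennreal p * emeasure lborel T)"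
    by (intro mult_left_mono le) auto
  also have "\<dots> = ennreal (p / q) * emeasure lborel T"
    using pq by (simp add: mult.assoc[symmetric] ennreal_mult[symmetric])
  finally show ?thesis
    using D(4) by (intro that[of "?U D"]) auto
qed

text \<open>Monotonicity excludes \<open>small_slope\<close> for negative \<open>p\<close>. For
  \<open>0 \<le> p\<close> the contraction is iterated: it yields open sets that cover up to null
  sets and whose measures fall like \<open>(p / q) ^ n\<close>. The window
  \<open>ball 0 (real k)\<close> makes the first of these measures finite.\<close>

lemma negligible_slope_gap:
  fixes F :: "real \<Rightarrow> real"
  assumes F: "mono F" "continuous_on UNIV F" and pq: "p < q"
  shows "negligible {x. small_slope F p x \<and> large_slope F q x}"
proof (cases "0 \<le> p")
  case False
  have "\<not> small_slope F p x" for x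
  proof
    assume "small_slope F p x"
    then obtain c r where r: "0 < r" "F (c + r) - F (c - r) < p * (2 * r)"
      unfolding small_slope_def by (meson zero_less_one)
    have "F (c - r) \<le> F (c + r)"
      using r by (intro monoD[OF F(1)]) simp
    moreover have "p * (2 * r) < 0"
      using False r by (simp add: mult_neg_pos)
    ultimately show False
      using r by linarith
  qed
  then show ?thesis
    by simp
next
  case True
  let ?N = "{x. small_slope F p x \<and> large_slope F q x}"
  have "negligible (?N \<inter> ball 0 (real k))" for k
  proof -
    let ?E = "?N \<inter> ball 0 (real k)"
    have step: "\<exists>T. open T \<and> negligible (?E - T) \<and> emeasure lborel T \<le> ennreal ((p / q) ^ n * (2 * real k))" for n
    proof (induction n)
      case 0
      show ?case
      proof (intro exI conjI)
        show "negligible (?E - ball (0::real) (real k))"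
          by (simp add: Diff_eq inf_assoc)
        show "emeasure lborel (ball (0::real) (real k)) \<le> ennreal ((p / q) ^ 0 * (2 * real k))"
          unfolding ball_eq_greaterThanLessThan
          by (subst emeasure_lborel_Ioo) simp_all
      qed simp
    next
      case (Suc n)
      then obtain T where T: "open T" "negligible (?E - T)"
        "emeasure lborel T \<le> ennreal ((p / q) ^ n * (2 * real k))" by blast
      obtain T' where T': "open T'" "negligible (?E - T')"
        "emeasure lborel T' \<le> ennreal (p / q) * emeasure lborel T"
        by (rule slope_gap_contraction[OF F True pq _ T(1,2)]) auto
      note T'(3)
      also have "ennreal (p / q) * emeasure lborel T \<le> ennreal (p / q) * ennreal ((p / q) ^ n * (2 * real k))"
        by (intro mult_left_mono T(3)) auto
      also have "\<dots> = ennreal ((p / q) ^ Suc n * (2 * real k))"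
        using True pq by (simp add: ennreal_mult[symmetric] mult.assoc)
      finally show ?case
        using T' by blast
    qed
    show ?thesis
      unfolding negligible_outer_le
    proof (intro allI impI)
      fix e :: real assume e: "0 < e"
      have "(\<lambda>n. (p / q) ^ n * (2 * real k)) \<longlonglongrightarrow> 0 * (2 * real k)"
        using True pq by (intro tendsto_intros LIMSEQ_realpow_zero) auto
      then have "\<forall>\<^sub>F n in sequentially. (p / q) ^ n * (2 * real k) < e"
        using e by (intro order_tendstoD) auto
      then obtain n where n: "(p / q) ^ n * (2 * real k) < e"
        by (auto simp: eventually_sequentially)
      obtain T where T: "open T" "negligible (?E - T)"
        "emeasure lborel T \<le> ennreal ((p / q) ^ n * (2 * real k))"
        using step by blast
      have T1: "emeasure lebesgue T \<le> ennreal e"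
        using T(1) n order_trans[OF T(3) ennreal_leI[of _ e]] by simp
      then have lT: "T \<in> lmeasurable"
        using T(1) by (intro fmeasurableI) (auto intro: order.strict_trans1)
      then have mT: "measure lebesgue T \<le> e"
        using T1 e by (simp add: emeasure_eq_measure2)
      have neg: "?E - T \<in> lmeasurable" "measure lebesgue (?E - T) = 0"
        using T(2) by (auto simp: negligible_imp_measurable negligible_imp_measure0)
      show "\<exists>S. ?E \<subseteq> S \<and> S \<in> lmeasurable \<and> measure lebesgue S \<le> e"
      proof (intro exI[of _ "T \<union> (?E - T)"] conjI)
        show "T \<union> (?E - T) \<in> lmeasurable"
          using lT neg(1) by blast
        show "measure lebesgue (T \<union> (?E - T)) \<le> e"
          using measure_Un_le[of T lebesgue "?E - T"] lT neg mT by (auto simp: fmeasurableD)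
      qed auto
    qed
  qed
  then have "negligible (\<Union>k. ?N \<inter> ball 0 (real k))"
    by (intro negligible_countable_Union) auto
  moreover have "(\<Union>k. ?N \<inter> ball 0 (real k)) = ?N"
    by (auto intro: reals_Archimedean2)
  ultimately show ?thesis
    by simp
qed


text \<open>Slopes are controlled on open balls around \<open>x\<close>, whereas a difference
  quotient at \<open>x\<close> has \<open>x\<close> as an end point. Widening the interval by
  \<open>s\<close> on both sides and letting \<open>s\<close> tend to 0 bridges this by
  continuity.\<close>

lemma slope_bounds_imp_secant_bounds:
  fixes F :: "real \<Rightarrow> real"
  assumes F: "continuous_on UNIV F" and d: "0 < d"
    and bnd: "\<And>c r. 0 < r \<Longrightarrow> r < d \<Longrightarrow> x \<in> ball c r \<Longrightarrow>
       m * (2 * r) \<le> F (c + r) - F (c - r) \<and> F (c + r) - F (c - r) \<le> M * (2 * r)"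
    and uv: "u \<le> x" "x \<le> v" "v - u < d"
  shows "m * (v - u) \<le> F v - F u \<and> F v - F u \<le> M * (v - u)"
proof -
  have ev: "\<forall>\<^sub>F s in at_right 0. m * (v - u + 2 * s) \<le> F (v + s) - F (u - s) \<and>
                           F (v + s) - F (u - s) \<le> M * (v - u + 2 * s)"
    unfolding eventually_at_right_field
  proof (intro exI conjI allI impI)
    show "0 < d / 2"
      using d by simp
    fix s :: real assume s: "0 < s" "s < d / 2"
    have "x \<in> ball ((u + v) / 2) ((v - u) / 2 + s)"
      unfolding ball_eq_greaterThanLessThan using uv s by (simp add: field_simps)
    moreover have "0 < (v - u) / 2 + s" "(v - u) / 2 + s < d"
      using uv s by (simp_all add: field_simps)
    ultimately have b: "m * (2 * ((v - u) / 2 + s)) \<le> F ((u + v) / 2 + ((v - u) / 2 + s)) - F ((u + v) / 2 - ((v - u) / 2 + s))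
      \<and> F ((u + v) / 2 + ((v - u) / 2 + s)) - F ((u + v) / 2 - ((v - u) / 2 + s)) \<le> M * (2 * ((v - u) / 2 + s))"
      using bnd by blast
    have eqs: "(u + v) / 2 + ((v - u) / 2 + s) = v + s" "(u + v) / 2 - ((v - u) / 2 + s) = u - s"
      "2 * ((v - u) / 2 + s) = v - u + 2 * s"
      by (simp_all add: field_simps)
    show "m * (v - u + 2 * s) \<le> F (v + s) - F (u - s)"
      "F (v + s) - F (u - s) \<le> M * (v - u + 2 * s)"
      using b unfolding eqs by simp_all
  qed
  have tF: "((\<lambda>s. F (h s)) \<longlongrightarrow> F (h 0)) (at_right 0)" if "continuous_on UNIV h" for h :: "real \<Rightarrow> real"
    using continuous_on_compose2[OF F that] by (auto simp: continuous_on_def intro: tendsto_within_subset)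
  have tv: "((\<lambda>s. F (v + s) - F (u - s)) \<longlongrightarrow> F (v + 0) - F (u - 0)) (at_right 0)"
    by (intro tendsto_diff tF continuous_intros)
  have tm: "((\<lambda>s. c * (v - u + 2 * s)) \<longlongrightarrow> c * (v - u + 2 * 0)) (at_right 0)" for c :: real
    by (intro tendsto_intros)
  have "m * (v - u + 2 * 0) \<le> F (v + 0) - F (u - 0)"
    by (rule tendsto_le[OF trivial_limit_at_right_real tv tm]) (use ev in \<open>auto elim: eventually_mono\<close>)
  moreover have "F (v + 0) - F (u - 0) \<le> M * (v - u + 2 * 0)"
    by (rule tendsto_le[OF trivial_limit_at_right_real tm tv]) (use ev in \<open>auto elim: eventually_mono\<close>)
  ultimately show ?thesis
    by simp
qed

text \<open>The derivative is the upper derivate \<open>D\<close>, the infimum of the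
  \<open>q\<close> that slopes near \<open>x\<close> do not exceed. Every rational
  \<open>q' < D\<close> is exceeded on arbitrarily short intervals, so the absence of gaps forbids
  slopes below a rational \<open>p < q'\<close> near \<open>x\<close>. The Lipschitz constant makes
  \<open>Q\<close> nonempty, monotonicity bounds it below.\<close>

lemma differentiable_if_no_slope_gap:
  fixes F :: "real \<Rightarrow> real"
  assumes F: "mono F" "L-lipschitz_on UNIV F"
    and gap: "\<And>p q. p \<in> \<rat> \<Longrightarrow> q \<in> \<rat> \<Longrightarrow> p < q \<Longrightarrow> \<not> (small_slope F p x \<and> large_slope F q x)"
  shows "F differentiable (at x)"
proof -
  have cont: "continuous_on UNIV F"
    using F(2) lipschitz_on_continuous_on by blast
  define Q where "Q = {q. \<not> large_slope F q x}"
  define D where "D = Inf Q"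
  have not_neg: "large_slope F q x" if "q < 0" for q
    unfolding large_slope_def
  proof (intro allI impI)
    fix d :: real assume d: "0 < d"
    have "F (x - d / 2) \<le> F (x + d / 2)"
      using d by (intro monoD[OF F(1)]) simp
    moreover have "q * (2 * (d / 2)) < 0"
      using that d by (simp add: mult_neg_pos)
    ultimately have "F (x + d / 2) - F (x - d / 2) > q * (2 * (d / 2))"
      by linarith
    then show "\<exists>c r. 0 < r \<and> r < d \<and> x \<in> ball c r \<and> F (c + r) - F (c - r) > q * (2 * r)"
      using d by (intro exI[of _ x] exI[of _ "d / 2"]) simp
  qed
  then have bdd: "bdd_below Q"
    by (intro bdd_belowI[of _ 0]) (force simp: Q_def not_less[symmetric])
  have "L \<in> Q"
  proof -
    have "\<not> F (c + r) - F (c - r) > L * (2 * r)" if "0 < r" for c r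
      using lipschitz_onD[OF F(2), of "c + r" "c - r"] that by (simp add: dist_real_def)
    then show ?thesis
      unfolding Q_def large_slope_def by (auto intro: exI[of _ 1])
  qed
  have key: "\<exists>d>0. \<forall>u v. u \<le> x \<and> x \<le> v \<and> v - u < d \<longrightarrow>
      (D - e) * (v - u) \<le> F v - F u \<and> F v - F u \<le> (D + e) * (v - u)" if e: "0 < e" for e
  proof -
    obtain q where q: "q \<in> Q" "q < D + e"
      using cInf_lessD[of Q "D + e"] \<open>L \<in> Q\<close> e unfolding D_def by auto
    then obtain d1 where d1: "0 < d1"
      "\<And>c r. 0 < r \<Longrightarrow> r < d1 \<Longrightarrow> x \<in> ball c r \<Longrightarrow> F (c + r) - F (c - r) \<le> q * (2 * r)"
      unfolding Q_def large_slope_def mem_Collect_eq by (meson not_less)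
    obtain q' where q': "q' \<in> \<rat>" "D - e / 2 < q'" "q' < D"
      using Rats_dense_in_real[of "D - e/2" D] e by auto
    obtain p where p: "p \<in> \<rat>" "D - e < p" "p < D - e / 2"
      using Rats_dense_in_real[of "D - e" "D - e/2"] e by auto
    have "large_slope F q' x"
      using cInf_lower[OF _ bdd, of q'] q'(3) unfolding D_def Q_def by auto
    then have "\<not> small_slope F p x"
      using gap[OF p(1) q'(1)] p q' by auto
    then obtain d2 where d2: "0 < d2"
      "\<And>c r. 0 < r \<Longrightarrow> r < d2 \<Longrightarrow> x \<in> ball c r \<Longrightarrow> p * (2 * r) \<le> F (c + r) - F (c - r)"
      unfolding small_slope_def by (meson not_less)
    have b: "p * (v - u) \<le> F v - F u \<and> F v - F u \<le> q * (v - u)"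
      if "u \<le> x" "x \<le> v" "v - u < min d1 d2" for u v
      by (rule slope_bounds_imp_secant_bounds[OF cont _ _ that]) (use d1 d2 in auto)
    show ?thesis
    proof (intro exI[of _ "min d1 d2"] conjI allI impI)
      fix u v assume uv: "u \<le> x \<and> x \<le> v \<and> v - u < min d1 d2"
      have "(D - e) * (v - u) \<le> p * (v - u)" "q * (v - u) \<le> (D + e) * (v - u)"
        using uv p q by (auto intro!: mult_right_mono)
      then show "(D - e) * (v - u) \<le> F v - F u" "F v - F u \<le> (D + e) * (v - u)"
        using b[of u v] uv by auto
    qed (use d1 d2 in auto)
  qed
  have "(F has_derivative (\<lambda>h. h * D)) (at x)"
    unfolding has_derivative_at_alt
  proof (intro conjI allI impI)
    show "bounded_linear (\<lambda>h. h * D)"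
      by (rule bounded_linear_mult_left)
    fix e :: real assume "0 < e"
    from key[OF this] obtain d where d: "0 < d" "\<forall>u v. u \<le> x \<and> x \<le> v \<and> v - u < d \<longrightarrow>
      (D - e) * (v - u) \<le> F v - F u \<and> F v - F u \<le> (D + e) * (v - u)"
      by (elim exE conjE)
    show "\<exists>d>0. \<forall>y. norm (y - x) < d \<longrightarrow> norm (F y - F x - (y - x) * D) \<le> e * norm (y - x)"
    proof (intro exI[of _ d] conjI allI impI)
      fix y assume y: "norm (y - x) < d"
      show "norm (F y - F x - (y - x) * D) \<le> e * norm (y - x)"
      proof (cases "x \<le> y")
        case True
        then show ?thesis
          using d(2)[rule_format, of x y] y by (auto simp: abs_le_iff algebra_simps)
      next
        case False
        then show ?thesis
          using d(2)[rule_format, of y x] y by (auto simp: abs_le_iff algebra_simps)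
      qed
    qed (use d in auto)
  qed
  then show ?thesis
    by (auto simp: differentiable_def)
qed

lemma Rademacher_mono_real:
  fixes F :: "real \<Rightarrow> real"
  assumes F: "mono F" "L-lipschitz_on UNIV F"
  shows "negligible {x. \<not> F differentiable (at x)}"
proof -
  have cont: "continuous_on UNIV F"
    using F(2) lipschitz_on_continuous_on by blast
  let ?N = "\<lambda>(p, q). {x. small_slope F p x \<and> large_slope F q x}"
  let ?R = "{(p, q) \<in> \<rat> \<times> \<rat>. p < q}"
  have "countable ?R"
    by (rule countable_subset[of _ "\<rat> \<times> \<rat>"]) (auto simp: countable_rat)
  then have "countable (?N ` ?R)"
    by (rule countable_image)
  then have "negligible (\<Union> (?N ` ?R))"
    by (rule negligible_countable_Union) (use negligible_slope_gap[OF F(1) cont] in auto)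
  moreover have "{x. \<not> F differentiable (at x)} \<subseteq> \<Union> (?N ` ?R)"
    using differentiable_if_no_slope_gap[OF F] by fastforce
  ultimately show ?thesis
    by (rule negligible_subset)
qed

text \<open>Adding \<open>L * t\<close> makes each coordinate nondecreasing and, being smooth, does
  not change where the coordinate is differentiable.\<close>

theorem Rademacher_curve:
  fixes f :: "real \<Rightarrow> 'a::euclidean_space"
  assumes f: "L-lipschitz_on UNIV f"
  shows "negligible {x. \<not> f differentiable (at x)}"
proof -
  have "negligible {x. \<not> (\<lambda>t. f t \<bullet> b) differentiable (at x)}" if b: "b \<in> Basis" for b
  proof -
    let ?F = "\<lambda>t. f t \<bullet> b + L * t"
    have le: "\<bar>f s \<bullet> b - f t \<bullet> b\<bar> \<le> L * \<bar>s - t\<bar>" for s t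
      using order_trans[OF Basis_le_norm[OF b, of "f s - f t"]] lipschitz_onD[OF f, of s t]
      by (simp add: dist_norm inner_diff_left)
    have "mono ?F"
    proof (rule monoI)
      fix s t :: real assume "s \<le> t"
      then show "?F s \<le> ?F t"
        using le[of s t] by (auto simp: algebra_simps abs_le_iff)
    qed
    moreover have "(2 * L)-lipschitz_on UNIV ?F"
    proof (rule lipschitz_onI)
      show "0 \<le> 2 * L"
        using lipschitz_on_nonneg[OF f] by simp
      fix s t :: real
      have "\<bar>L * s - L * t\<bar> = L * \<bar>s - t\<bar>"
        using lipschitz_on_nonneg[OF f] by (simp add: abs_mult right_diff_distrib[symmetric])
      then show "dist (?F s) (?F t) \<le> 2 * L * dist s t"
        using le[of s t] unfolding dist_real_def by linarith
    qed
    ultimately have "negligible {x. \<not> ?F differentiable (at x)}"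
      by (rule Rademacher_mono_real)
    moreover have "(\<lambda>t. f t \<bullet> b) differentiable (at x)" if "?F differentiable (at x)" for x
    proof -
      have "(\<lambda>t. ?F t - L * t) differentiable (at x)"
        by (intro differentiable_diff that) simp
      then show ?thesis
        by simp
    qed
    ultimately show ?thesis
      by (elim negligible_subset) auto
  qed
  then have "negligible (\<Union>b\<in>Basis. {x. \<not> (\<lambda>t. f t \<bullet> b) differentiable (at x)})"
    by (intro negligible_Union) auto
  moreover have "{x. \<not> f differentiable (at x)} = (\<Union>b\<in>Basis. {x. \<not> (\<lambda>t. f t \<bullet> b) differentiable (at x)})"
    using differentiable_componentwise_within[of f _ UNIV] by auto
  ultimately show ?thesis
    by simp
qed

section \<open>The projected field\<close>

lemma continuous_on_ip_norm:
  assumes "is_inner_product B"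
  shows "continuous_on S (\<lambda>v. ip_norm B (v - c))"
proof -
  have "bounded_bilinear B"
    using assms by (simp add: is_inner_product_def bilinear_conv_bounded_bilinear)
  then show ?thesis
    unfolding ip_norm_def
    by (intro continuous_on_real_sqrt bounded_bilinear.continuous_on[of B] continuous_intros)
qed

lemma ip_norm_scaleR:
  assumes "is_inner_product B"
  shows "ip_norm B (c *\<^sub>R v) = \<bar>c\<bar> * ip_norm B v"
  using assms by (simp add: is_inner_product_def ip_norm_def bilinear_lmul bilinear_rmul
      real_sqrt_mult mult.assoc[symmetric])

text \<open>\<open>GREATEST\<close> and \<open>LEAST\<close> are meaningful once the extremes are
  attained, which compactness of the unit sphere guarantees; homogeneity carries the bounds to all
  vectors.\<close>

lemma ip_norm_bounds:
  fixes B :: "'a::euclidean_space \<Rightarrow> 'a \<Rightarrow> real"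
  assumes B: "is_inner_product B"
  shows "0 < lambda_min B" "lambda_min B * norm v \<le> ip_norm B v" "ip_norm B v \<le> lambda_max B * norm v"
proof -
  let ?S = "{v::'a. norm v = 1}"
  obtain e :: 'a where "norm e = 1"
    using norm_Basis nonempty_Basis by blast
  then have S: "compact ?S" "?S \<noteq> {}"
    using compact_sphere[of "0::'a" 1] by (auto simp: sphere_def)
  have cont: "continuous_on ?S (ip_norm B)"
    using continuous_on_ip_norm[OF B, of ?S 0] by simp
  obtain a where a: "a \<in> ?S" "\<And>u. u \<in> ?S \<Longrightarrow> ip_norm B a \<le> ip_norm B u"
    using continuous_attains_inf[OF S cont] by auto
  obtain b where b: "b \<in> ?S" "\<And>u. u \<in> ?S \<Longrightarrow> ip_norm B u \<le> ip_norm B b"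
    using continuous_attains_sup[OF S cont] by auto
  have mn: "lambda_min B = ip_norm B a"
    unfolding lambda_min_def by (rule Least_equality) (use a in auto)
  have mx: "lambda_max B = ip_norm B b"
    unfolding lambda_max_def by (rule Greatest_equality) (use b in auto)
  show "0 < lambda_min B"
    using a(1) B unfolding mn is_inner_product_def ip_norm_def by (cases "a = 0") auto
  have "lambda_min B * norm v \<le> ip_norm B v \<and> ip_norm B v \<le> lambda_max B * norm v"
  proof (cases "v = 0")
    case True
    then show ?thesis
      using ip_norm_scaleR[OF B, of 0 v] by simp
  next
    case False
    then have u: "v /\<^sub>R norm v \<in> ?S"
      by simp
    have "ip_norm B v = norm v * ip_norm B (v /\<^sub>R norm v)"
      using False by (simp add: ip_norm_scaleR[OF B])
    then show ?thesis
      using a(2)[OF u] b(2)[OF u] by (simp add: mn mx mult.commute mult_left_mono)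
  qed
  then show "lambda_min B * norm v \<le> ip_norm B v" "ip_norm B v \<le> lambda_max B * norm v"
    by auto
qed

text \<open>One tolerance replaces the two sequences. In this form an Euler step picks its end
  point, and closedness of the cone becomes an \<open>e / 2\<close> argument.\<close>

lemma tangent_cone_iff:
  "v \<in> tangent_cone X x \<longleftrightarrow>
     (\<forall>e>0. \<exists>z\<in>X. \<exists>h. 0 < h \<and> h < e \<and> norm (z - x) < e \<and> norm ((z - x) /\<^sub>R h - v) < e)"
    (is "_ \<longleftrightarrow> ?R")
proof
  assume "v \<in> tangent_cone X x"
  then obtain xs \<delta> where s: "\<And>k. xs k \<in> X" "xs \<longlonglongrightarrow> x" "\<And>k. (\<delta> k :: real) > 0" "\<delta> \<longlonglongrightarrow> 0"
    "(\<lambda>k. (xs k - x) /\<^sub>R \<delta> k) \<longlonglongrightarrow> v"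
    unfolding tangent_cone_def by auto
  show ?R
  proof (intro allI impI)
    fix e :: real assume e: "0 < e"
    have "\<forall>\<^sub>F k in sequentially. dist (xs k) x < e \<and> \<delta> k < e \<and> dist ((xs k - x) /\<^sub>R \<delta> k) v < e"
      using e by (intro eventually_conj tendstoD[OF s(2)] tendstoD[OF s(5)] order_tendstoD[OF s(4)])
    then obtain k where "dist (xs k) x < e \<and> \<delta> k < e \<and> dist ((xs k - x) /\<^sub>R \<delta> k) v < e"
      by (auto simp: eventually_sequentially)
    then show "\<exists>z\<in>X. \<exists>h. 0 < h \<and> h < e \<and> norm (z - x) < e \<and> norm ((z - x) /\<^sub>R h - v) < e"
      using s by (intro bexI[of _ "xs k"] exI[of _ "\<delta> k"]) (auto simp: dist_norm)
  qed
next
  assume R: ?R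
  have "\<exists>z h. z \<in> X \<and> 0 < h \<and> h < inverse (real (Suc k)) \<and> norm (z - x) < inverse (real (Suc k)) \<and>
          norm ((z - x) /\<^sub>R h - v) < inverse (real (Suc k))" for k
    using R[rule_format, of "inverse (real (Suc k))"] by auto
  then obtain xs where "\<forall>k. \<exists>h. xs k \<in> X \<and> 0 < h \<and> h < inverse (real (Suc k)) \<and>
      norm (xs k - x) < inverse (real (Suc k)) \<and> norm ((xs k - x) /\<^sub>R h - v) < inverse (real (Suc k))"
    by (rule choice[OF allI, THEN exE])
  then obtain \<delta> where "\<forall>k. xs k \<in> X \<and> 0 < \<delta> k \<and> \<delta> k < inverse (real (Suc k)) \<and>
      norm (xs k - x) < inverse (real (Suc k)) \<and> norm ((xs k - x) /\<^sub>R \<delta> k - v) < inverse (real (Suc k))"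
    by (rule choice[THEN exE])
  then have s: "\<And>k. xs k \<in> X" "\<And>k. 0 < \<delta> k" "\<And>k. norm (\<delta> k) \<le> inverse (real (Suc k))"
    "\<And>k. norm (xs k - x) \<le> inverse (real (Suc k))"
    "\<And>k. norm ((xs k - x) /\<^sub>R \<delta> k - v) \<le> inverse (real (Suc k))"
    by (auto simp: less_imp_le)
  have null: "u \<longlonglongrightarrow> 0" if "\<And>k. norm (u k) \<le> inverse (real (Suc k))" for u :: "nat \<Rightarrow> 'b::real_normed_vector"
    by (rule Lim_null_comparison[OF _ LIMSEQ_inverse_real_of_nat]) (simp add: that del: of_nat_Suc)
  have "xs \<longlonglongrightarrow> x" "\<delta> \<longlonglongrightarrow> 0" "(\<lambda>k. (xs k - x) /\<^sub>R \<delta> k) \<longlonglongrightarrow> v"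
    by (rule LIM_zero_cancel, rule null, rule s) (rule null, rule s, rule LIM_zero_cancel, rule null, rule s)
  then show "v \<in> tangent_cone X x"
    using s(1,2) unfolding tangent_cone_def mem_Collect_eq by (intro exI conjI allI) assumption+
qed

lemma zero_in_tangent_cone:
  assumes "x \<in> X"
  shows "0 \<in> tangent_cone X x"
  unfolding tangent_cone_iff
proof (intro allI impI)
  fix e :: real assume "0 < e"
  then show "\<exists>z\<in>X. \<exists>h. 0 < h \<and> h < e \<and> norm (z - x) < e \<and> norm ((z - x) /\<^sub>R h - 0) < e"
    using assms by (intro bexI[of _ x] exI[of _ "e / 2"]) auto
qed

lemma closed_tangent_cone: "closed (tangent_cone X x)"
proof -
  have "v \<in> tangent_cone X x" if v: "v \<in> closure (tangent_cone X x)" for v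
    unfolding tangent_cone_iff
  proof (intro allI impI)
    fix e :: real assume e: "0 < e"
    obtain w where w: "w \<in> tangent_cone X x" "dist w v < e / 2"
      using v half_gt_zero[OF e] unfolding closure_approachable by blast
    obtain z h where zh: "z \<in> X" "0 < h" "h < e / 2" "norm (z - x) < e / 2" "norm ((z - x) /\<^sub>R h - w) < e / 2"
      using w(1)[unfolded tangent_cone_iff, rule_format, OF half_gt_zero[OF e]] by auto
    have "norm ((z - x) /\<^sub>R h - v) < e"
      using norm_triangle_lt[of "(z - x) /\<^sub>R h - w" "w - v" e] zh w by (simp add: dist_norm)
    then show "\<exists>z\<in>X. \<exists>h. 0 < h \<and> h < e \<and> norm (z - x) < e \<and> norm ((z - x) /\<^sub>R h - v) < e"
      using zh e by (intro bexI[of _ z] exI[of _ h]) auto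
  qed
  then show ?thesis
    by (metis closure_subset closure_eq subsetI subset_antisym)
qed

lemma projected_field_iff:
  assumes "is_inner_product (g x)"
  shows "v \<in> projected_field X g f x \<longleftrightarrow>
    v \<in> tangent_cone X x \<and> (\<forall>u\<in>tangent_cone X x. ip_norm (g x) (v - f x) \<le> ip_norm (g x) (u - f x))"
proof -
  have "0 \<le> ip_norm (g x) u" for u
    using assms by (cases "u = 0") (auto simp: ip_norm_def is_inner_product_def bilinear_lzero less_imp_le)
  then show ?thesis
    by (auto simp: projected_field_def is_arg_min_linorder power_mono_iff)
qed

text \<open>The tangent cone is closed but need not be convex, so the minimum comes from
  compactness: \<open>0\<close> is tangent, and the vectors that do at least as well as
  \<open>0\<close> form a bounded set because \<open>lambda_min\<close> is positive.\<close>

lemma projected_field_nonempty: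
  assumes g: "is_inner_product (g x)" and x: "x \<in> X"
  shows "projected_field X g f x \<noteq> {}"
proof -
  let ?d = "\<lambda>v. ip_norm (g x) (v - f x)"
  define K where "K = tangent_cone X x \<inter> {v. ?d v \<le> ?d 0}"
  have "closed {v. ?d v \<le> ?d 0}"
    using closed_Collect_le[OF continuous_on_ip_norm[OF g] continuous_on_const] .
  moreover have "bounded {v. ?d v \<le> ?d 0}"
  proof (rule boundedI)
    fix v assume "v \<in> {v. ?d v \<le> ?d 0}"
    then have "lambda_min (g x) * norm (v - f x) \<le> ?d 0"
      using ip_norm_bounds(2)[OF g, of "v - f x"] by auto
    then have "norm (v - f x) \<le> ?d 0 / lambda_min (g x)"
      using ip_norm_bounds(1)[OF g] by (simp add: field_simps)
    then show "norm v \<le> ?d 0 / lambda_min (g x) + norm (f x)"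
      using norm_triangle_sub[of v "f x"] by linarith
  qed
  ultimately have "compact K"
    unfolding K_def using closed_tangent_cone[of X x] by (simp add: compact_eq_bounded_closed closed_Int bounded_Int)
  moreover have "0 \<in> K"
    using zero_in_tangent_cone[OF x] by (simp add: K_def)
  ultimately obtain v where v: "v \<in> K" "\<And>u. u \<in> K \<Longrightarrow> ?d v \<le> ?d u"
    using continuous_attains_inf[of K ?d, OF _ _ continuous_on_ip_norm[OF g]] by auto
  have "?d v \<le> ?d u" if "u \<in> tangent_cone X x" for u
    using v(2)[of u] v(1) that by (cases "u \<in> K") (auto simp: K_def)
  then have "v \<in> projected_field X g f x"
    using v(1) by (auto simp: projected_field_iff[of g x, OF g] K_def)
  then show ?thesis
    by blast
qed

text \<open>Comparing the minimiser with the tangent vector \<open>0\<close> gives \<open>lambda_min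
  (g x) * norm (v - f x) \<le> lambda_max (g x) * norm (f x)\<close>. Only the ratio matters, and
  that is what weak boundedness controls.\<close>

lemma norm_projected_field_le:
  assumes g: "is_inner_product (g x)" and x: "x \<in> X" and v: "v \<in> projected_field X g f x"
  shows "norm v \<le> (1 + condition_number (g x)) * norm (f x)"
proof -
  have "lambda_min (g x) * norm (v - f x) \<le> ip_norm (g x) (v - f x)"
    by (rule ip_norm_bounds[OF g])
  also have "\<dots> \<le> ip_norm (g x) (0 - f x)"
    using v zero_in_tangent_cone[OF x] by (auto simp: projected_field_iff[of g x, OF g])
  also have "\<dots> \<le> lambda_max (g x) * norm (0 - f x)"
    by (rule ip_norm_bounds[OF g])
  finally have "norm (v - f x) \<le> condition_number (g x) * norm (f x)"
    using ip_norm_bounds(1)[OF g] by (simp add: condition_number_def field_simps)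
  then show ?thesis
    using norm_triangle_sub[of v "f x"] by (simp add: algebra_simps)
qed

lemma locally_bounded_projected_field:
  assumes f: "locally_bounded_on X f" and g: "metric_on X g" "locally_weakly_bounded X g" and x: "x \<in> X"
  shows "\<exists>M>0. \<exists>e>0. \<forall>y\<in>X \<inter> ball x e. \<forall>v\<in>projected_field X g f y. norm v \<le> M"
proof -
  obtain M e where M: "M > 0" "e > 0" "\<And>y. y \<in> X \<inter> ball x e \<Longrightarrow> norm (f y) \<le> M"
    using f x unfolding locally_bounded_on_def by meson
  obtain L' e' where L': "L' > 0" "e' > 0" "\<And>y. y \<in> X \<inter> ball x e' \<Longrightarrow> condition_number (g y) \<le> L'"
    using g(2) x unfolding locally_weakly_bounded_def by meson
  have "norm v \<le> (1 + L') * M"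
    if y: "y \<in> X \<inter> ball x (min e e')" and v: "v \<in> projected_field X g f y" for y v
  proof -
    have "norm v \<le> (1 + condition_number (g y)) * norm (f y)"
      using norm_projected_field_le[of g y, OF _ _ v] y g(1) by (auto simp: metric_on_def)
    also have "\<dots> \<le> (1 + L') * norm (f y)"
      using L'(3)[of y] y by (intro mult_right_mono) auto
    also have "\<dots> \<le> (1 + L') * M"
      using M(3)[of y] L'(1) y by (intro mult_left_mono) auto
    finally show "norm v \<le> (1 + L') * M" .
  qed
  moreover have "0 < (1 + L') * M" "0 < min e e'"
    using M L' by simp_all
  ultimately show ?thesis
    by blast
qed

section \<open>Curves with prescribed mean velocities\<close>

text \<open>Not divided by \<open>b - a\<close>: errors then add over adjacent intervals, and at
  \<open>a = b\<close> the condition reduces to \<open>A \<noteq> {}\<close>.\<close>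

definition velocity_in :: "(real \<Rightarrow> 'a::euclidean_space) \<Rightarrow> 'a set \<Rightarrow> real \<Rightarrow> real \<Rightarrow> real \<Rightarrow> bool" where
  "velocity_in x A e a b \<longleftrightarrow> (\<exists>w\<in>A. norm (x b - x a - (b - a) *\<^sub>R w) \<le> e * (b - a))"

text \<open>Averaging \<open>w1\<close> and \<open>w2\<close> with weights proportional to the
  lengths gives a witness in the convex set \<open>A\<close>; the errors, proportional to length,
  add up exactly.\<close>

lemma velocity_in_trans:
  assumes A: "convex A" and ab: "velocity_in x A e a b" and bc: "velocity_in x A e b c"
    and le: "a \<le> b" "b \<le> c"
  shows "velocity_in x A e a c"
proof (cases "a = c")
  case True
  then show ?thesis
    using ab le by auto
next
  case False
  obtain w1 where w1: "w1 \<in> A" "norm (x b - x a - (b - a) *\<^sub>R w1) \<le> e * (b - a)"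
    using ab unfolding velocity_in_def by blast
  obtain w2 where w2: "w2 \<in> A" "norm (x c - x b - (c - b) *\<^sub>R w2) \<le> e * (c - b)"
    using bc unfolding velocity_in_def by blast
  define w where "w = ((b - a) / (c - a)) *\<^sub>R w1 + ((c - b) / (c - a)) *\<^sub>R w2"
  have "(b - a) / (c - a) + (c - b) / (c - a) = 1"
    using False le by (simp add: add_divide_distrib[symmetric])
  then have wA: "w \<in> A"
    unfolding w_def using A w1(1) w2(1) le by (intro convexD) auto
  have "(c - a) *\<^sub>R w = (b - a) *\<^sub>R w1 + (c - b) *\<^sub>R w2"
    using False le by (simp add: w_def scaleR_add_right)
  then have eq: "x c - x a - (c - a) *\<^sub>R w
      = (x b - x a - (b - a) *\<^sub>R w1) + (x c - x b - (c - b) *\<^sub>R w2)"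
    by simp
  have "norm (x c - x a - (c - a) *\<^sub>R w) \<le> e * (b - a) + e * (c - b)"
    unfolding eq by (rule norm_triangle_mono[OF w1(2) w2(2)])
  then show ?thesis
    unfolding velocity_in_def using wA by (auto simp: algebra_simps)
qed

text \<open>Trades slack in the set for slack in the error, as needed to return from a thickening to
  the set itself.\<close>

lemma velocity_in_mono:
  assumes "velocity_in x A e a b" "a \<le> b" "e + e' \<le> e''"
    and "\<And>w. w \<in> A \<Longrightarrow> \<exists>w'\<in>A'. norm (w - w') \<le> e'"
  shows "velocity_in x A' e'' a b"
proof -
  obtain w where w: "w \<in> A" "norm (x b - x a - (b - a) *\<^sub>R w) \<le> e * (b - a)"
    using assms(1) unfolding velocity_in_def by blast
  obtain w' where w': "w' \<in> A'" "norm (w - w') \<le> e'"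
    using assms(4)[OF w(1)] by blast
  have "norm ((b - a) *\<^sub>R (w - w')) \<le> e' * (b - a)"
    using mult_left_mono[OF w'(2), of "b - a"] assms(2) by (simp add: mult.commute)
  then have "norm ((x b - x a - (b - a) *\<^sub>R w) + (b - a) *\<^sub>R (w - w')) \<le> e * (b - a) + e' * (b - a)"
    by (rule norm_triangle_mono[OF w(2)])
  also have "\<dots> \<le> e'' * (b - a)"
    using mult_right_mono[OF assms(3), of "b - a"] assms(2) by (simp add: algebra_simps)
  finally show ?thesis
    unfolding velocity_in_def using w'(1) by (intro bexI[of _ w']) (simp_all add: scaleR_diff_right)
qed

lemma velocity_in_subset: "velocity_in x A e a b \<Longrightarrow> A \<subseteq> A' \<Longrightarrow> velocity_in x A' e a b"
  unfolding velocity_in_def by blast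

text \<open>The length \<open>d\<close> depends on \<open>t\<close> without uniformity.
  \<open>Bolzano\<close> (bisection of the interval) supplies the compactness, and
  \<open>velocity_in_trans\<close> the additivity it asks for.\<close>

lemma velocity_in_if_local:
  assumes A: "convex A" and uv: "u \<le> v"
    and loc: "\<And>t. u \<le> t \<Longrightarrow> t \<le> v \<Longrightarrow> \<exists>d>0. \<forall>a b. u \<le> a \<and> a \<le> t \<and> t \<le> b \<and> b \<le> v \<and> b - a < d \<longrightarrow> velocity_in x A e a b"
  shows "velocity_in x A e u v"
proof -
  have "u \<le> u \<and> v \<le> v \<longrightarrow> velocity_in x A e u v"
    using uv
  proof (induction rule: Bolzano[where P = "\<lambda>a b. u \<le> a \<and> b \<le> v \<longrightarrow> velocity_in x A e a b"])
    case (trans a b c)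
    then show ?case
      using velocity_in_trans[OF A] by auto
  next
    case (local t)
    then show ?case
      using loc[of t] by blast
  qed
  then show ?thesis
    by simp
qed

text \<open>A gauge condition in the manner of the Henstock integral: \<open>t\<close> tags the
  interval, \<open>d\<close> may depend on \<open>t\<close>, and only the set at the tag is used.
  Neither a derivative nor a measurable selection occurs.\<close>

definition approx_sol :: "('a::euclidean_space \<Rightarrow> 'a set) \<Rightarrow> real \<Rightarrow> (real \<Rightarrow> 'a) \<Rightarrow> real \<Rightarrow> bool" where
  "approx_sol H e x S \<longleftrightarrow> (\<forall>t\<in>{0..S}. \<exists>d>0. \<forall>a b.
     0 \<le> a \<and> a \<le> t \<and> t \<le> b \<and> b \<le> S \<and> b - a < d \<longrightarrow> velocity_in x (H (x t)) e a b)"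

lemma approx_sol_restrict:
  assumes "approx_sol H e x S" "S' \<le> S"
  shows "approx_sol H e x S'"
  unfolding approx_sol_def
proof
  fix t assume t: "t \<in> {0..S'}"
  then obtain d where d: "d > 0" "\<And>a b. 0 \<le> a \<Longrightarrow> a \<le> t \<Longrightarrow> t \<le> b \<Longrightarrow> b \<le> S \<Longrightarrow> b - a < d \<Longrightarrow> velocity_in x (H (x t)) e a b"
    using assms unfolding approx_sol_def by (metis atLeastAtMost_iff order_trans)
  then show "\<exists>d>0. \<forall>a b. 0 \<le> a \<and> a \<le> t \<and> t \<le> b \<and> b \<le> S' \<and> b - a < d \<longrightarrow> velocity_in x (H (x t)) e a b"
    using assms(2) by (intro exI[of _ d]) auto
qed

lemma approx_sol_cong:
  assumes "approx_sol H e x S" "\<And>t. 0 \<le> t \<Longrightarrow> t \<le> S \<Longrightarrow> x t = y t"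
  shows "approx_sol H e y S"
proof -
  have "velocity_in y (H (y t)) e a b"
    if "velocity_in x (H (x t)) e a b" "0 \<le> a" "a \<le> t" "t \<le> b" "b \<le> S" for t a b
    using that assms(2)[of a] assms(2)[of t] assms(2)[of b] by (simp add: velocity_in_def)
  then show ?thesis
    using assms(1) unfolding approx_sol_def by meson
qed

lemma approx_sol_velocity_in:
  assumes x: "approx_sol H e x S" and A: "convex A"
    and uv: "0 \<le> u" "u \<le> v" "v \<le> S" and sub: "\<And>t. u \<le> t \<Longrightarrow> t \<le> v \<Longrightarrow> H (x t) \<subseteq> A"
  shows "velocity_in x A e u v"
proof (rule velocity_in_if_local[OF A uv(2)])
  fix t assume t: "u \<le> t" "t \<le> v"
  obtain d where d: "d > 0" "\<And>a b. 0 \<le> a \<Longrightarrow> a \<le> t \<Longrightarrow> t \<le> b \<Longrightarrow> b \<le> S \<Longrightarrow> b - a < d \<Longrightarrow> velocity_in x (H (x t)) e a b"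
    using x t uv unfolding approx_sol_def by (metis atLeastAtMost_iff order_trans)
  then show "\<exists>d>0. \<forall>a b. u \<le> a \<and> a \<le> t \<and> t \<le> b \<and> b \<le> v \<and> b - a < d \<longrightarrow> velocity_in x A e a b"
    using uv by (intro exI[of _ d]) (auto intro!: velocity_in_subset[OF _ sub[OF t]])
qed

lemma velocity_in_cball_imp_norm_le:
  assumes "velocity_in x (cball 0 M) e a b" "a \<le> b"
  shows "norm (x b - x a) \<le> (M + e) * (b - a)"
proof -
  obtain w where w: "norm w \<le> M" "norm (x b - x a - (b - a) *\<^sub>R w) \<le> e * (b - a)"
    using assms(1) unfolding velocity_in_def by auto
  have "norm ((b - a) *\<^sub>R w) \<le> M * (b - a)"
    using mult_left_mono[OF w(1), of "b - a"] assms(2) by (simp add: mult.commute)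
  then show ?thesis
    using norm_triangle_mono[OF w(2), of "(b - a) *\<^sub>R w" "M * (b - a)"]
    by (simp add: distrib_right add.commute)
qed

lemma approx_sol_lipschitz:
  assumes x: "approx_sol H e x S" and M: "0 \<le> M + e"
    and sub: "\<And>t. t \<in> {0..S} \<Longrightarrow> H (x t) \<subseteq> cball 0 M"
  shows "(M + e)-lipschitz_on {0..S} x"
proof (rule lipschitz_onI[OF _ M])
  have le: "norm (x v - x u) \<le> (M + e) * (v - u)" if "0 \<le> u" "u \<le> v" "v \<le> S" for u v
    by (rule velocity_in_cball_imp_norm_le[OF approx_sol_velocity_in[OF x convex_cball that] that(2)])
      (use sub that in auto)
  fix s t assume "s \<in> {0..S}" "t \<in> {0..S}"
  then show "dist (x s) (x t) \<le> (M + e) * dist s t"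
    using le[of s t] le[of t s] by (cases "s \<le> t") (auto simp: dist_norm norm_minus_commute)
qed

definition concat_at :: "real \<Rightarrow> (real \<Rightarrow> 'a) \<Rightarrow> (real \<Rightarrow> 'a) \<Rightarrow> real \<Rightarrow> 'a" where
  "concat_at S x y t = (if t \<le> S then x t else y (t - S))"

text \<open>Away from the junction \<open>d\<close> is cut so that intervals stay on one side of
  \<open>S\<close>. At \<open>t = S\<close> an interval is split at the tag; since
  \<open>y 0 = x S\<close>, both halves refer to the same set, and convexity joins them.\<close>

lemma approx_sol_concat:
  assumes H: "\<And>y. convex (H y)" and S: "0 \<le> S"
    and x: "approx_sol H e x S" and y: "approx_sol H e y h" and eq: "y 0 = x S"
  shows "approx_sol H e (concat_at S x y) (S + h)"
  unfolding approx_sol_def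
proof
  let ?z = "concat_at S x y"
  fix t assume t: "t \<in> {0..S + h}"
  have zx: "?z s = x s" if "s \<le> S" for s
    using that by (simp add: concat_at_def)
  have zy: "?z s = y (s - S)" if "S \<le> s" for s
    using that eq by (cases "s = S") (auto simp: concat_at_def)
  have vx: "velocity_in ?z A e a b" if "velocity_in x A e a b" "a \<le> b" "b \<le> S" for a b A
    using that by (simp add: velocity_in_def zx)
  have vy: "velocity_in ?z A e a b" if "velocity_in y A e (a - S) (b - S)" "S \<le> a" "a \<le> b" for a b A
    using that by (simp add: velocity_in_def zy)
  have x': "\<exists>d>0. \<forall>a b. 0 \<le> a \<and> a \<le> t \<and> t \<le> b \<and> b \<le> S \<and> b - a < d \<longrightarrow> velocity_in x (H (x t)) e a b"
    if "t \<le> S"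
    using x t that unfolding approx_sol_def by auto
  have y': "\<exists>d>0. \<forall>a b. 0 \<le> a \<and> a \<le> t - S \<and> t - S \<le> b \<and> b \<le> h \<and> b - a < d \<longrightarrow> velocity_in y (H (y (t - S))) e a b"
    if "S \<le> t"
    using y t that unfolding approx_sol_def by auto
  show "\<exists>d>0. \<forall>a b. 0 \<le> a \<and> a \<le> t \<and> t \<le> b \<and> b \<le> S + h \<and> b - a < d \<longrightarrow> velocity_in ?z (H (?z t)) e a b"
  proof (cases t S rule: linorder_cases)
    case less
    then obtain d where d: "d > 0" "\<And>a b. 0 \<le> a \<and> a \<le> t \<and> t \<le> b \<and> b \<le> S \<and> b - a < d \<Longrightarrow> velocity_in x (H (x t)) e a b"
      using x' by auto
    then show ?thesis
      using less by (intro exI[of _ "min d (S - t)"]) (auto simp: zx intro!: vx)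
  next
    case equal
    then obtain d where d: "d > 0" "\<And>a b. 0 \<le> a \<and> a \<le> t \<and> t \<le> b \<and> b \<le> S \<and> b - a < d \<Longrightarrow> velocity_in x (H (x t)) e a b"
      using x' by auto
    obtain d' where d': "d' > 0" "\<And>a b. 0 \<le> a \<and> a \<le> t - S \<and> t - S \<le> b \<and> b \<le> h \<and> b - a < d' \<Longrightarrow> velocity_in y (H (y (t - S))) e a b"
      using y' equal by auto
    have "velocity_in ?z (H (?z t)) e a b"
      if ab: "0 \<le> a" "a \<le> t" "t \<le> b" "b \<le> S + h" "b - a < min d d'" for a b
    proof (rule velocity_in_trans[OF H _ _ ab(2,3)])
      show "velocity_in ?z (H (?z t)) e a t"
        unfolding zx[OF eq_refl[OF equal]] by (rule vx) (use ab equal d(2)[of a t] in auto)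
      show "velocity_in ?z (H (?z t)) e t b"
        unfolding zy[OF eq_refl[OF equal[symmetric]]] by (rule vy) (use ab equal d'(2)[of 0 "b - S"] in auto)
    qed
    then show ?thesis
      using d d' by (intro exI[of _ "min d d'"]) auto
  next
    case greater
    then obtain d where d: "d > 0" "\<And>a b. 0 \<le> a \<and> a \<le> t - S \<and> t - S \<le> b \<and> b \<le> h \<and> b - a < d \<Longrightarrow> velocity_in y (H (y (t - S))) e a b"
      using y' by auto
    then show ?thesis
      using greater by (intro exI[of _ "min d (t - S)"]) (auto simp: zy intro!: vy)
  qed
qed

text \<open>An Euler direction \<open>u\<close> need not belong to \<open>H\<close>; it is only
  within \<open>e\<close> of a field value \<open>v\<close>, which has to be admissible along the
  whole segment.\<close>

lemma approx_sol_segment: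
  assumes "\<And>t. t \<in> {0..h} \<Longrightarrow> v \<in> H (p + t *\<^sub>R u)" "norm (u - v) \<le> e"
  shows "approx_sol H e (\<lambda>t. p + t *\<^sub>R u) h"
proof -
  have "velocity_in (\<lambda>t. p + t *\<^sub>R u) A e a b" if "v \<in> A" "a \<le> b" for A a b
    unfolding velocity_in_def
  proof (intro bexI[OF _ that(1)])
    have "p + b *\<^sub>R u - (p + a *\<^sub>R u) - (b - a) *\<^sub>R v = (b - a) *\<^sub>R (u - v)"
      by (simp add: algebra_simps)
    then show "norm (p + b *\<^sub>R u - (p + a *\<^sub>R u) - (b - a) *\<^sub>R v) \<le> e * (b - a)"
      using mult_left_mono[OF assms(2), of "b - a"] that(2) by (simp add: mult.commute)
  qed
  then show ?thesis
    using assms(1) unfolding approx_sol_def by (auto intro!: exI[of _ 1])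
qed

lemma thickening_compact:
  fixes A :: "'a::euclidean_space set"
  assumes "compact A"
  shows "closed {v. \<exists>w\<in>A. norm (v - w) \<le> e}"
proof -
  have "{v. \<exists>w\<in>A. norm (v - w) \<le> e} = (\<Union>x\<in>A. \<Union>y\<in>cball 0 e. {x + y})"
    by (force intro: bexI[of _ "_ - _"])
  then show ?thesis
    using compact_closed_sums[OF assms closed_cball[of 0 e]] by simp
qed

lemma thickening_convex:
  fixes A :: "'a::real_normed_vector set"
  assumes "convex A"
  shows "convex {v. \<exists>w\<in>A. norm (v - w) \<le> e}"
proof -
  have "{v. \<exists>w\<in>A. norm (v - w) \<le> e} = (\<Union>x\<in>A. \<Union>y\<in>cball 0 e. {x + y})"
    by (force intro: bexI[of _ "_ - _"])
  then show ?thesis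
    using convex_sums[OF assms convex_cball[of 0 e]] by simp
qed

lemma lipschitz_imp_absolutely_continuous:
  assumes x: "C-lipschitz_on I x"
  shows "absolutely_continuous_curve_on I x"
  unfolding absolutely_continuous_curve_on_def
proof (intro allI impI)
  fix \<epsilon> :: real assume \<epsilon>: "0 < \<epsilon>"
  have C: "0 \<le> C"
    using lipschitz_on_nonneg[OF x] .
  show "\<exists>\<delta>>0. \<forall>D :: (real \<times> real) set.
        finite D \<and> (\<forall>(a, b)\<in>D. a \<le> b \<and> {a..b} \<subseteq> I) \<and>
        pairwise (\<lambda>p q. disjnt {fst p<..<snd p} {fst q<..<snd q}) D \<and>
        (\<Sum>(a, b)\<in>D. b - a) < \<delta> \<longrightarrow> (\<Sum>(a, b)\<in>D. norm (x b - x a)) < \<epsilon>"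
  \<comment> \<open>The \<open>+ 1\<close> keeps the quotient meaningful for
    \<open>C = 0\<close>.\<close>
  proof (intro exI[of _ "\<epsilon> / (C + 1)"] conjI allI impI)
    show "0 < \<epsilon> / (C + 1)"
      using \<epsilon> C by simp
    fix D :: "(real \<times> real) set"
    assume D: "finite D \<and> (\<forall>(a, b)\<in>D. a \<le> b \<and> {a..b} \<subseteq> I) \<and>
        pairwise (\<lambda>p q. disjnt {fst p<..<snd p} {fst q<..<snd q}) D \<and>
        (\<Sum>(a, b)\<in>D. b - a) < \<epsilon> / (C + 1)"
    have "(\<Sum>(a, b)\<in>D. norm (x b - x a)) \<le> (\<Sum>(a, b)\<in>D. (C + 1) * (b - a))"
    proof (rule sum_mono)
      fix p assume "p \<in> D"
      then obtain a b where p: "p = (a, b)" and ab: "a \<le> b" "{a..b} \<subseteq> I"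
        using D by (cases p) auto
      then have "norm (x b - x a) \<le> C * (b - a)"
        using lipschitz_onD[OF x, of b a] by (simp add: dist_norm subset_iff)
      also have "\<dots> \<le> (C + 1) * (b - a)"
        using ab by (intro mult_right_mono) auto
      finally show "(case p of (a, b) \<Rightarrow> norm (x b - x a)) \<le> (case p of (a, b) \<Rightarrow> (C + 1) * (b - a))"
        by (simp add: p)
    qed
    also have "\<dots> = (C + 1) * (\<Sum>(a, b)\<in>D. b - a)"
      by (simp add: sum_distrib_left case_prod_beta)
    also have "\<dots> < \<epsilon>"
      using D C by (simp add: field_simps)
    finally show "(\<Sum>(a, b)\<in>D. norm (x b - x a)) < \<epsilon>" .
  qed
qed

section \<open>Fields selecting tangent directions\<close>

text \<open>What existence takes from \<open>f\<close> and \<open>g\<close>. Semicontinuity is not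
  among these properties; it is supplied by the regularization.\<close>

locale tangent_field =
  fixes X :: "'a::euclidean_space set" and F :: "'a \<Rightarrow> 'a set"
  assumes locally_compact: "locally_compact_set X"
    and nonempty: "y \<in> X \<Longrightarrow> F y \<noteq> {}"
    and tangent: "y \<in> X \<Longrightarrow> F y \<subseteq> tangent_cone X y"
    and bounded_near: "y \<in> X \<Longrightarrow> \<exists>M>0. \<exists>e>0. \<forall>z\<in>X \<inter> ball y e. \<forall>v\<in>F z. norm v \<le> M"
begin

abbreviation "K \<equiv> krasovskii X F"

lemma field_subset_K:
  assumes "y \<in> X"
  shows "F y \<subseteq> K y"
proof -
  have "F y \<subseteq> outer_limit X F y"
    unfolding outer_limit_def using assms by (auto intro!: exI[of _ "\<lambda>_. y"] exI[of _ "\<lambda>_. _"])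
  then show ?thesis
    unfolding krasovskii_def using closure_subset hull_subset by (metis subset_trans)
qed

lemma K_nonempty: "y \<in> X \<Longrightarrow> K y \<noteq> {}"
  using field_subset_K nonempty by blast

lemma K_convex: "convex (K y)"
  unfolding krasovskii_def by (intro convex_closure convex_convex_hull)

text \<open>Sequences tending to \<open>y\<close> are eventually in the ball, so limits of field
  values stay in the closed set \<open>N\<close>, and neither hull nor closure leaves a closed
  convex set. Every such bound on the field near \<open>y\<close> thus becomes one on
  \<open>K y\<close>.\<close>

lemma K_subset_if_field_subset:
  assumes y: "y \<in> X" and d: "d > 0" and N: "closed N" "convex N"
    and sub: "\<And>z. z \<in> X \<inter> ball y d \<Longrightarrow> F z \<subseteq> N"
  shows "K y \<subseteq> N"
proof -
  have "outer_limit X F y \<subseteq> N"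
  proof
    fix v assume "v \<in> outer_limit X F y"
    then obtain xs vs where s: "\<And>k. xs k \<in> X" "xs \<longlonglongrightarrow> y" "\<And>k. vs k \<in> F (xs k)" "vs \<longlonglongrightarrow> v"
      unfolding outer_limit_def by auto
    have "\<forall>\<^sub>F k in sequentially. dist (xs k) y < d"
      using s(2) d by (rule tendstoD)
    then have "\<forall>\<^sub>F k in sequentially. vs k \<in> N"
    proof (rule eventually_mono)
      fix k assume "dist (xs k) y < d"
      then show "vs k \<in> N"
        using s(1,3)[of k] sub[of "xs k"] by (auto simp: dist_commute)
    qed
    then show "v \<in> N"
      using Lim_in_closed_set[OF N(1) _ _ s(4)] by simp
  qed
  then show ?thesis
    unfolding krasovskii_def by (intro closure_minimal hull_minimal N)
qed

lemma K_compact: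
  assumes y: "y \<in> X"
  shows "compact (K y)"
proof -
  obtain M e where M: "e > 0" "\<And>z v. z \<in> X \<inter> ball y e \<Longrightarrow> v \<in> F z \<Longrightarrow> norm v \<le> M"
    using bounded_near[OF y] by blast
  have "K y \<subseteq> cball 0 M"
    by (rule K_subset_if_field_subset[OF y M(1)]) (use M(2) in auto)
  then have "bounded (K y)"
    using bounded_subset bounded_cball by blast
  then show ?thesis
    unfolding compact_eq_bounded_closed krasovskii_def by simp
qed

text \<open>By contradiction: take points tending to \<open>y\<close> with field values farther than
  \<open>e\<close> from \<open>K y\<close>. By local boundedness a subsequence of the values
  converges, and its limit belongs to the outer limit, hence to \<open>K y\<close>.\<close>

lemma field_usc:
  assumes y: "y \<in> X" and e: "e > 0"
  shows "\<exists>d>0. \<forall>z\<in>X \<inter> ball y d. \<forall>v\<in>F z. \<exists>w\<in>K y. norm (v - w) \<le> e"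
proof (rule ccontr)
  assume no: "\<not> ?thesis"
  have "\<exists>z v. z \<in> X \<and> norm (z - y) < inverse (real (Suc k)) \<and> v \<in> F z \<and> (\<forall>w\<in>K y. norm (v - w) > e)" for k
  proof -
    have "\<not> (\<forall>z\<in>X \<inter> ball y (inverse (real (Suc k))). \<forall>v\<in>F z. \<exists>w\<in>K y. norm (v - w) \<le> e)"
      using no by (meson inverse_positive_iff_positive of_nat_0_less_iff zero_less_Suc)
    then show ?thesis
      by (force simp: dist_norm norm_minus_commute not_le simp del: of_nat_Suc)
  qed
  then obtain zs vs where s: "\<And>k. zs k \<in> X" "\<And>k. norm (zs k - y) < inverse (real (Suc k))"
    "\<And>k. vs k \<in> F (zs k)" "\<And>k w. w \<in> K y \<Longrightarrow> norm (vs k - w) > e"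
    by metis
  have lim: "zs \<longlonglongrightarrow> y"
    by (rule LIM_zero_cancel, rule Lim_null_comparison[OF _ LIMSEQ_inverse_real_of_nat])
      (use s(2) in \<open>auto intro!: always_eventually less_imp_le simp del: of_nat_Suc\<close>)
  obtain M d where M: "d > 0" "\<And>z v. z \<in> X \<inter> ball y d \<Longrightarrow> v \<in> F z \<Longrightarrow> norm v \<le> M"
    using bounded_near[OF y] by blast
  have "\<forall>\<^sub>F k in sequentially. dist (zs k) y < d"
    using lim M(1) by (rule tendstoD)
  then obtain n where n: "\<And>k. k \<ge> n \<Longrightarrow> dist (zs k) y < d"
    unfolding eventually_sequentially by blast
  \<comment> \<open>The shift by \<open>n\<close> discards the initial points, which may lie outside
    the ball where the field is bounded.\<close>
  have vb: "vs (k + n) \<in> cball 0 M" for k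
    using M(2)[of "zs (k + n)" "vs (k + n)"] s(1,3) n[of "k + n"] by (simp add: dist_commute)
  obtain l r where l: "strict_mono (r :: nat \<Rightarrow> nat)" "((\<lambda>k. vs (k + n)) \<circ> r) \<longlonglongrightarrow> l"
    using compact_cball[of "0::'a" M, unfolded compact_def, rule_format, of "\<lambda>k. vs (k + n)"] vb by auto
  have "(\<lambda>k. zs (k + n)) \<longlonglongrightarrow> y"
    using lim by (rule LIMSEQ_ignore_initial_segment)
  then have "((\<lambda>k. zs (k + n)) \<circ> r) \<longlonglongrightarrow> y"
    using l(1) by (rule LIMSEQ_subseq_LIMSEQ)
  then have "l \<in> outer_limit X F y"
    unfolding outer_limit_def mem_Collect_eq
    by (intro exI[of _ "(\<lambda>k. zs (k + n)) \<circ> r"] exI[of _ "(\<lambda>k. vs (k + n)) \<circ> r"]) (use s(1,3) l(2) in auto)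
  then have lK: "l \<in> K y"
    unfolding krasovskii_def using closure_subset hull_subset by (metis subsetD)
  have "\<forall>\<^sub>F k in sequentially. dist (((\<lambda>k. vs (k + n)) \<circ> r) k) l < e"
    using l(2) e by (rule tendstoD)
  then obtain k where "dist (((\<lambda>k. vs (k + n)) \<circ> r) k) l < e"
    unfolding eventually_sequentially by blast
  then show False
    using s(4)[OF lK, of "r k + n"] by (simp add: dist_norm)
qed

text \<open>The thickening of \<open>K y\<close> is closed and convex, and around every
  \<open>z\<close> in the ball a smaller ball still has its field values there; so
  \<open>K z\<close> inherits the inclusion from the field.\<close>

lemma K_usc:
  assumes y: "y \<in> X" and e: "e > 0"
  shows "\<exists>d>0. \<forall>z\<in>X \<inter> ball y d. \<forall>v\<in>K z. \<exists>w\<in>K y. norm (v - w) \<le> e"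
proof -
  let ?N = "{v. \<exists>w\<in>K y. norm (v - w) \<le> e}"
  obtain d where d: "d > 0" "\<And>z. z \<in> X \<inter> ball y d \<Longrightarrow> F z \<subseteq> ?N"
    using field_usc[OF y e] by blast
  have "K z \<subseteq> ?N" if z: "z \<in> X \<inter> ball y d" for z
  proof -
    have "d - dist y z > 0"
      using z by simp
    moreover have "ball z (d - dist y z) \<subseteq> ball y d"
    proof
      fix u assume "u \<in> ball z (d - dist y z)"
      then show "u \<in> ball y d"
        using dist_triangle[of y u z] by simp
    qed
    ultimately show ?thesis
      using z d(2) thickening_compact[OF K_compact[OF y]] thickening_convex[OF K_convex[of y]]
      by (intro K_subset_if_field_subset[of z "d - dist y z"]) blast+
  qed
  then show ?thesis
    using d(1) by blast
qed

section \<open>Euler polygons and local existence\<close>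

text \<open>Between two vertices a polygon may lie outside \<open>X\<close>, where \<open>F\<close>
  has no meaning; such points are given the field at nearby centres. The hull provides the convexity
  that concatenation requires.\<close>

definition euler_field :: "'a set \<Rightarrow> real \<Rightarrow> 'a \<Rightarrow> 'a set" where
  "euler_field B e p = convex hull (\<Union>c\<in>B \<inter> ball p e. F c)"

text \<open>
  Haddad's argument for the uniform lower bound h0: the end point reached from a centre c with step
  h serves, with the same h, as end point for all starting points in a small ball around c, and
  finitely many such balls cover B.
\<close>
lemma euler_step:
  assumes B: "compact B" "B \<subseteq> X" and e: "e > 0"
  shows "\<exists>h0>0. \<forall>y\<in>B. \<exists>h u. h0 \<le> h \<and> h < e \<and> y + h *\<^sub>R u \<in> X \<and>
           (\<exists>c\<in>B. norm (c - y) < e \<and> (\<exists>v\<in>F c. norm (u - v) \<le> e))"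
proof -
  have "\<exists>v z h. v \<in> F c \<and> z \<in> X \<and> 0 < h \<and> h < e \<and> norm ((z - c) /\<^sub>R h - v) < e / 2" if "c \<in> B" for c
  proof -
    have "c \<in> X"
      using that B(2) by blast
    then obtain v where v: "v \<in> F c" "v \<in> tangent_cone X c"
      using nonempty tangent by blast
    obtain z h where "z \<in> X" "0 < h" "h < e / 2" "norm ((z - c) /\<^sub>R h - v) < e / 2"
      using v(2)[unfolded tangent_cone_iff, rule_format, of "e / 2"] e by auto
    then show ?thesis
      using v(1) e by (intro exI[of _ v] exI[of _ z] exI[of _ h]) auto
  qed
  then have "\<forall>c\<in>B. \<exists>p. fst p \<in> F c \<and> fst (snd p) \<in> X \<and> 0 < snd (snd p) \<and> snd (snd p) < e \<and>
      norm ((fst (snd p) - c) /\<^sub>R snd (snd p) - fst p) < e / 2"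
    by fastforce
  then obtain P where P: "\<forall>c\<in>B. fst (P c) \<in> F c \<and> fst (snd (P c)) \<in> X \<and> 0 < snd (snd (P c)) \<and> snd (snd (P c)) < e \<and>
      norm ((fst (snd (P c)) - c) /\<^sub>R snd (snd (P c)) - fst (P c)) < e / 2"
    by (rule bchoice[THEN exE])
  define v z h where "v = fst \<circ> P" and "z = fst \<circ> snd \<circ> P" and "h = snd \<circ> snd \<circ> P"
  have vzh: "v c \<in> F c" "z c \<in> X" "0 < h c" "h c < e" "norm ((z c - c) /\<^sub>R h c - v c) < e / 2"
    if "c \<in> B" for c
    using P that by (auto simp: v_def z_def h_def)
  \<comment> \<open>Starting at \<open>y\<close> instead of \<open>c\<close> changes the difference
    quotient by \<open>norm (c - y) / h c\<close>, which must stay below \<open>e / 2\<close>; the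
    other half of \<open>e\<close> is the tangency error at \<open>c\<close>. The bound by
    \<open>e\<close> keeps \<open>c\<close> near \<open>y\<close>.\<close>
  define r where "r c = min e (h c * (e / 2))" for c
  have r: "r c > 0" if "c \<in> B" for c
    using vzh(3)[OF that] e by (simp add: r_def)
  have "B \<subseteq> (\<Union>c\<in>B. ball c (r c))"
    using r by (auto intro: bexI[of _ "_ :: 'a"])
  then obtain D where D: "D \<subseteq> B" "finite D" "B \<subseteq> (\<Union>c\<in>D. ball c (r c))"
    using compactE_image[OF B(1), of B "\<lambda>c. ball c (r c)"] by auto
  \<comment> \<open>Inserting \<open>e\<close> keeps the minimum defined when \<open>B\<close>, and
    with it \<open>D\<close>, is empty.\<close>
  define h0 where "h0 = Min (insert e (h ` D))"
  show ?thesis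
  proof (rule exI[of _ h0], intro conjI ballI)
    show "h0 > 0"
      unfolding h0_def using D(1,2) e vzh(3) by (subst Min_gr_iff) auto
    fix y assume "y \<in> B"
    then obtain c where c: "c \<in> D" "dist c y < r c"
      using D(3) by auto
    then have cB: "c \<in> B"
      using D(1) by blast
    note * = vzh[OF cB]
    define u where "u = (z c - y) /\<^sub>R h c"
    have "norm ((c - y) /\<^sub>R h c) = norm (c - y) / h c"
      using *(3) by (simp add: divide_inverse mult.commute)
    also have "\<dots> < e / 2"
      using c(2) *(3) by (simp add: r_def dist_norm field_simps)
    finally have cy: "norm ((c - y) /\<^sub>R h c) < e / 2" .
    have eq: "u - v c = ((z c - c) /\<^sub>R h c - v c) + (c - y) /\<^sub>R h c"
      by (simp add: u_def scaleR_diff_right)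
    have "norm (u - v c) < e"
      unfolding eq using norm_add_less[OF *(5) cy] by simp
    moreover have "h0 \<le> h c"
      unfolding h0_def using D(2) c(1) by (intro Min_le) auto
    moreover have "y + h c *\<^sub>R u = z c"
      using *(3) by (simp add: u_def)
    moreover have "norm (c - y) < e"
      using c(2) by (simp add: r_def dist_norm)
    ultimately show "\<exists>h u. h0 \<le> h \<and> h < e \<and> y + h *\<^sub>R u \<in> X \<and>
           (\<exists>c\<in>B. norm (c - y) < e \<and> (\<exists>v\<in>F c. norm (u - v) \<le> e))"
      using * cB by (intro exI[of _ "h c"] exI[of _ u] conjI bexI[of _ c] bexI[of _ "v c"]) auto
  qed
qed

text \<open>Directions have norm at most \<open>M + e \<le> M + 1\<close>, so vertices stay within
  \<open>\<rho>\<close> up to time \<open>2 * T\<close>; the factor 2 absorbs the last step, which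
  starts before \<open>T\<close> and is shorter than \<open>e \<le> T\<close>. A point is within
  \<open>(M + 1) * e\<close> of its vertex and the vertex within \<open>e\<close> of a centre,
  whence \<open>(M + 2) * e\<close>.\<close>

lemma euler_polygon:
  assumes B: "compact (X \<inter> cball p \<rho>)" and p: "p \<in> X" and M: "M > 0"
    and bnd: "\<And>y v. y \<in> X \<inter> cball p \<rho> \<Longrightarrow> v \<in> F y \<Longrightarrow> norm v \<le> M"
    and T: "0 < T" "(M + 1) * (2 * T) \<le> \<rho>" and e: "0 < e" "e \<le> 1" "e \<le> T"
  shows "\<exists>x. x 0 = p \<and> approx_sol (euler_field (X \<inter> cball p \<rho>) ((M + 2) * e)) e x T \<and>
    (M + 1)-lipschitz_on {0..T} x \<and> (\<forall>t\<in>{0..T}. \<exists>c\<in>X \<inter> cball p \<rho>. dist (x t) c \<le> (M + 1) * e)"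
proof -
  define B where "B = X \<inter> cball p \<rho>"
  define H where "H = euler_field B ((M + 2) * e)"
  have cB: "compact B" "B \<subseteq> X"
    using assms(1) by (auto simp: B_def)
  obtain h0 where h0: "h0 > 0" "\<And>y. y \<in> B \<Longrightarrow> \<exists>h u. h0 \<le> h \<and> h < e \<and> y + h *\<^sub>R u \<in> X \<and>
           (\<exists>c\<in>B. norm (c - y) < e \<and> (\<exists>v\<in>F c. norm (u - v) \<le> e))"
    using euler_step[OF cB e(1)] by blast
  have \<rho>: "0 \<le> \<rho>"
    using T M by (meson add_pos_pos less_imp_le mult_pos_pos order_trans zero_less_numeral zero_less_one)
  have Hconv: "convex (H y)" for y
    by (simp add: H_def euler_field_def convex_convex_hull)
  have HM: "H y \<subseteq> cball 0 M" for y
    unfolding H_def euler_field_def using bnd by (intro hull_minimal convex_cball) (auto simp: B_def)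
  define good where "good S x \<longleftrightarrow> 0 \<le> S \<and> x 0 = p \<and> x S \<in> X \<and> approx_sol H e x S \<and>
    (\<forall>t\<in>{0..S}. \<exists>c\<in>B. dist (x t) c \<le> (M + 1) * e)" for S and x :: "real \<Rightarrow> 'a"
  have lip: "(M + 1)-lipschitz_on {0..S} x" if "good S x" for S x
  proof -
    have "(M + e)-lipschitz_on {0..S} x"
      by (rule approx_sol_lipschitz[of H]) (use that HM M e in \<open>auto simp: good_def\<close>)
    then show ?thesis
      by (rule lipschitz_on_le) (use e in simp)
  qed
  have dist_start: "dist (x S) p \<le> (M + 1) * S" if "good S x" for S x
    using lipschitz_onD[OF lip[OF that], of S 0] that by (simp add: good_def)
  \<comment> \<open>Either time \<open>T\<close> is reached and the construction stops, or each step
    has gained at least \<open>h0\<close>; so finitely many steps suffice.\<close>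
  have "\<exists>S x. good S x \<and> S \<le> 2 * T \<and> (T \<le> S \<or> real n * h0 \<le> S)" for n
  proof (induction n)
    case 0
    have "p \<in> B"
      using p \<rho> by (simp add: B_def)
    \<comment> \<open>On a degenerate interval the condition only asks for an element of
      \<open>H p\<close>.\<close>
    moreover have "approx_sol H e (\<lambda>t. p) 0"
    proof -
      obtain v where "v \<in> F p"
        using nonempty[OF p] by blast
      then have "v \<in> H p"
        unfolding H_def euler_field_def using \<open>p \<in> B\<close> M e by (intro hull_inc) auto
      then show ?thesis
        by (auto simp: approx_sol_def velocity_in_def intro!: exI[of _ 1])
    qed
    ultimately have "good 0 (\<lambda>t. p)"
      using p M e by (auto simp: good_def intro!: bexI[of _ p])
    then show ?case
      using T by auto
  next
    case (Suc n)
    then obtain S x where x: "good S x" and S: "S \<le> 2 * T" "T \<le> S \<or> real n * h0 \<le> S"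
      by blast
    show ?case
    proof (cases "T \<le> S")
      case True
      then show ?thesis
        using x S by blast
    next
      case False
      have S0: "0 \<le> S"
        using x by (simp add: good_def)
      have "(M + 1) * S \<le> (M + 1) * (2 * T)"
        using False S0 M by (intro mult_left_mono) auto
      then have xB: "x S \<in> B"
        using dist_start[OF x] T(2) x by (auto simp: B_def good_def dist_commute)
      obtain h u c v where h: "h0 \<le> h" "h < e" "x S + h *\<^sub>R u \<in> X"
        and c: "c \<in> B" "norm (c - x S) < e" "v \<in> F c" "norm (u - v) \<le> e"
        using h0(2)[OF xB] by blast
      have u: "norm u \<le> M + 1"
        using norm_triangle_sub[of u v] bnd[of c v] c e by (auto simp: B_def)
      let ?y = "\<lambda>t. x S + t *\<^sub>R u"
      have near: "norm (t *\<^sub>R u) \<le> (M + 1) * e" if "t \<in> {0..h}" for t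
        using mult_mono[of t e "norm u" "M + 1"] that u M h(2) by (simp add: mult.commute)
      have "approx_sol H e ?y h"
      proof (rule approx_sol_segment[OF _ c(4)])
        fix t assume t: "t \<in> {0..h}"
        have "dist (x S + t *\<^sub>R u) c \<le> norm (t *\<^sub>R u) + norm (c - x S)"
          using norm_triangle_ineq4[of "t *\<^sub>R u" "c - x S"] by (simp add: dist_norm algebra_simps)
        then have "dist (x S + t *\<^sub>R u) c < (M + 2) * e"
          using near[OF t] c(2) by (simp add: algebra_simps)
        then show "v \<in> H (x S + t *\<^sub>R u)"
          unfolding H_def euler_field_def using c by (intro hull_inc) auto
      qed
      then have "approx_sol H e (concat_at S x ?y) (S + h)"
        using x S0 by (intro approx_sol_concat Hconv) (auto simp: good_def)
      moreover have "\<exists>c\<in>B. dist (concat_at S x ?y t) c \<le> (M + 1) * e" if t: "t \<in> {0..S + h}" for t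
      proof (cases "t \<le> S")
        case True
        then show ?thesis
          using x t by (auto simp: good_def concat_at_def)
      next
        case False
        then show ?thesis
          using near[of "t - S"] t by (intro bexI[OF _ xB]) (auto simp: concat_at_def dist_norm)
      qed
      ultimately have "good (S + h) (concat_at S x ?y)"
        using x S0 h h0(1) by (auto simp: good_def concat_at_def)
      moreover have "S + h \<le> 2 * T"
        using False h(2) e(3) by linarith
      moreover have "real (Suc n) * h0 \<le> S + h"
        using S(2) False h(1) by (auto simp: algebra_simps)
      ultimately show ?thesis
        by blast
    qed
  qed note step = this
  obtain n where "T < real n * h0"
    using ex_less_of_nat_mult[OF h0(1)] by blast
  then obtain S x where x: "good S x" "T \<le> S"
    using step[of n] by fastforce
  have sub: "{0..T} \<subseteq> {0..S}"
    using x(2) by auto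
  show ?thesis
    unfolding B_def[symmetric] H_def[symmetric]
    using x sub approx_sol_restrict[of H e x S T] lipschitz_on_subset[OF lip[OF x(1)] sub]
    by (intro exI[of _ x]) (auto simp: good_def)
qed

definition sol :: "real \<Rightarrow> (real \<Rightarrow> 'a) \<Rightarrow> bool" where
  "sol S x \<longleftrightarrow> x ` {0..S} \<subseteq> X \<and> (\<forall>e>0. approx_sol K e x S)"

text \<open>Convergence at the two end points suffices: the increments lie in a thickening of
  \<open>A\<close> scaled by \<open>b - a\<close>, which is closed because \<open>A\<close> is
  compact.\<close>

lemma closed_velocity_in_limit:
  assumes A: "compact A" and lim: "\<And>s. s \<in> {a, b} \<Longrightarrow> (\<lambda>n. xs n s) \<longlonglongrightarrow> x s"
    and ev: "\<forall>\<^sub>F n in sequentially. velocity_in (xs n) A e a b"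
  shows "velocity_in x A e a b"
proof -
  let ?N = "{p. \<exists>w\<in>(\<lambda>w. (b - a) *\<^sub>R w) ` A. norm (p - w) \<le> e * (b - a)}"
  have "closed ?N"
    by (intro thickening_compact compact_scaling A)
  moreover have "(\<lambda>n. xs n b - xs n a) \<longlonglongrightarrow> x b - x a"
    by (intro tendsto_diff lim) auto
  moreover have "\<forall>\<^sub>F n in sequentially. xs n b - xs n a \<in> ?N"
    using ev by (rule eventually_mono) (auto simp: velocity_in_def)
  ultimately have "x b - x a \<in> ?N"
    by (intro Lim_in_closed_set[where F = sequentially]) simp_all
  then show ?thesis
    by (auto simp: velocity_in_def)
qed

lemma local_existence:
  assumes p: "p \<in> X"
  shows "\<exists>T>0. \<exists>x. x 0 = p \<and> sol T x"
proof -
  obtain C U where CU: "closed C" "open U" "X = C \<inter> U"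
    using locally_compact[unfolded locally_compact_set_def] by (elim exE conjE)
  have "p \<in> U"
    using p CU(3) by simp
  then obtain r1 where r1: "r1 > 0" "cball p r1 \<subseteq> U"
    using CU(2) unfolding open_contains_cball by blast
  obtain M r2 where M: "M > 0" "r2 > 0" "\<And>z v. z \<in> X \<inter> ball p r2 \<Longrightarrow> v \<in> F z \<Longrightarrow> norm v \<le> M"
    using bounded_near[OF p] by blast
  \<comment> \<open>\<open>r1\<close> keeps the ball inside \<open>U\<close>, so that
    \<open>B\<close> is cut out by the closed set \<open>C\<close>; halving \<open>r2\<close> puts
    the closed ball inside the open one on which the field is bounded.\<close>
  define \<rho> where "\<rho> = min r1 (r2 / 2)"
  have \<rho>: "\<rho> > 0" "\<rho> \<le> r1" "\<rho> < r2"
    using r1 M by (auto simp: \<rho>_def)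
  define B where "B = X \<inter> cball p \<rho>"
  have "cball p \<rho> \<subseteq> U"
    using r1(2) subset_cball[OF \<rho>(2), of p] by (rule subset_trans[rotated])
  then have "B = C \<inter> cball p \<rho>"
    unfolding B_def CU(3) by blast
  then have B: "compact B"
    using CU(1) by (simp add: closed_Int_compact)
  have BM: "norm v \<le> M" if "y \<in> B" "v \<in> F y" for y v
  proof (rule M(3)[OF _ that(2)])
    show "y \<in> X \<inter> ball p r2"
      using that(1) \<rho>(3) by (simp add: B_def)
  qed
  define T where "T = \<rho> / (2 * (M + 1))"
  have T: "T > 0" "(M + 1) * (2 * T) \<le> \<rho>"
    using \<rho> M by (simp_all add: T_def field_simps)
  define \<epsilon> where "\<epsilon> n = min 1 T * inverse (real (Suc n))" for n
  have \<epsilon>: "0 < \<epsilon> n" "\<epsilon> n \<le> 1" "\<epsilon> n \<le> T" for n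
  proof -
    have "inverse (real (Suc n)) \<le> 1"
      by (simp add: field_simps)
    then have "\<epsilon> n \<le> min 1 T * 1"
      unfolding \<epsilon>_def using T by (intro mult_left_mono) auto
    then show "0 < \<epsilon> n" "\<epsilon> n \<le> 1" "\<epsilon> n \<le> T"
      using T by (auto simp: \<epsilon>_def)
  qed
  have "\<epsilon> \<longlonglongrightarrow> min 1 T * 0"
    unfolding \<epsilon>_def by (intro tendsto_intros LIMSEQ_inverse_real_of_nat)
  then have \<epsilon>0: "\<epsilon> \<longlonglongrightarrow> 0"
    by simp
  have "\<forall>n. \<exists>x. x 0 = p \<and> approx_sol (euler_field B ((M + 2) * \<epsilon> n)) (\<epsilon> n) x T \<and>
    (M + 1)-lipschitz_on {0..T} x \<and> (\<forall>t\<in>{0..T}. \<exists>c\<in>B. dist (x t) c \<le> (M + 1) * \<epsilon> n)"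
    unfolding B_def
    by (intro allI euler_polygon[OF B[unfolded B_def] p M(1) BM[unfolded B_def] T] \<epsilon>)
  then obtain xs where "\<forall>n. xs n 0 = p \<and> approx_sol (euler_field B ((M + 2) * \<epsilon> n)) (\<epsilon> n) (xs n) T \<and>
    (M + 1)-lipschitz_on {0..T} (xs n) \<and> (\<forall>t\<in>{0..T}. \<exists>c\<in>B. dist (xs n t) c \<le> (M + 1) * \<epsilon> n)"
    by (rule choice[THEN exE])
  then have xs: "\<And>n. xs n 0 = p"
    "\<And>n. approx_sol (euler_field B ((M + 2) * \<epsilon> n)) (\<epsilon> n) (xs n) T"
    "\<And>n. (M + 1)-lipschitz_on {0..T} (xs n)"
    "\<And>n t. t \<in> {0..T} \<Longrightarrow> \<exists>c\<in>B. dist (xs n t) c \<le> (M + 1) * \<epsilon> n"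
    by blast+
  have bound: "norm (xs n t) \<le> norm p + (M + 1) * T" if "t \<in> {0..T}" for n t
  proof -
    have "dist (xs n t) p \<le> (M + 1) * dist t 0"
      using lipschitz_onD[OF xs(3), of t 0 n] that xs(1)[of n] T by auto
    also have "\<dots> \<le> (M + 1) * T"
      using that M by (intro mult_left_mono) auto
    finally show ?thesis
      using norm_triangle_sub[of "xs n t" p] by (simp add: dist_norm)
  qed
  have equi: "\<exists>d>0. \<forall>n s. s \<in> {0..T} \<and> norm (t - s) < d \<longrightarrow> norm (xs n t - xs n s) < e"
    if "t \<in> {0..T}" "0 < e" for t e
  proof (intro exI[of _ "e / (M + 1)"] conjI allI impI)
    show "0 < e / (M + 1)"
      using that M by simp
    fix n s assume s: "s \<in> {0..T} \<and> norm (t - s) < e / (M + 1)"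
    have "norm (xs n t - xs n s) \<le> (M + 1) * norm (t - s)"
      using lipschitz_onD[OF xs(3), of t s n] that s by (simp add: dist_norm)
    also have "\<dots> < e"
      using s M by (simp add: field_simps)
    finally show "norm (xs n t - xs n s) < e" .
  qed
  obtain x k where x: "continuous_on {0..T} x" "strict_mono (k :: nat \<Rightarrow> nat)"
    "\<And>e. 0 < e \<Longrightarrow> \<exists>N. \<forall>n t. n \<ge> N \<and> t \<in> {0..T} \<longrightarrow> norm (xs (k n) t - x t) < e"
    by (rule Arzela_Ascoli[of "{0..T}" xs, OF compact_Icc bound equi]) blast+
  have \<epsilon>k: "(\<lambda>n. \<epsilon> (k n)) \<longlonglongrightarrow> 0"
    using LIMSEQ_subseq_LIMSEQ[OF \<epsilon>0 x(2)] by (simp add: o_def)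
  have lim: "(\<lambda>n. xs (k n) t) \<longlonglongrightarrow> x t" if "t \<in> {0..T}" for t
    unfolding LIMSEQ_iff using x(3) that by blast
  have x0: "x 0 = p"
    using lim[of 0] xs(1) T by (simp add: LIMSEQ_const_iff)
  \<comment> \<open>The polygons may leave \<open>X\<close>, but points of the closed set
    \<open>B\<close> come arbitrarily close to them, so the limit curve lies in
    \<open>B\<close>.\<close>
  have xB: "x t \<in> B" if t: "t \<in> {0..T}" for t
  proof -
    have "\<forall>n. \<exists>c. c \<in> B \<and> dist (xs (k n) t) c \<le> (M + 1) * \<epsilon> (k n)"
      using xs(4)[OF t] by blast
    then obtain c where "\<forall>n. c n \<in> B \<and> dist (xs (k n) t) (c n) \<le> (M + 1) * \<epsilon> (k n)"
      by (rule choice[THEN exE])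
    then have c: "\<And>n. c n \<in> B" "\<And>n. dist (xs (k n) t) (c n) \<le> (M + 1) * \<epsilon> (k n)"
      by blast+
    have "(\<lambda>n. (M + 1) * \<epsilon> (k n)) \<longlonglongrightarrow> (M + 1) * 0"
      by (intro tendsto_intros \<epsilon>k)
    then have "(\<lambda>n. xs (k n) t - c n) \<longlonglongrightarrow> 0"
      using c(2) by (intro Lim_null_comparison[of "\<lambda>n. xs (k n) t - c n" "\<lambda>n. (M + 1) * \<epsilon> (k n)"])
        (auto simp: dist_norm)
    then have "(\<lambda>n. xs (k n) t - (xs (k n) t - c n)) \<longlonglongrightarrow> x t - 0"
      by (intro tendsto_diff lim t)
    then have "c \<longlonglongrightarrow> x t"
      by simp
    then show ?thesis
      using closed_sequentially[OF compact_imp_closed[OF B], of c] c(1) by blast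
  qed
  have "approx_sol K e x T" if e: "0 < e" for e
    unfolding approx_sol_def
  proof
    fix t assume t: "t \<in> {0..T}"
    then have tX: "x t \<in> X"
      using xB by (auto simp: B_def)
    let ?N = "{v. \<exists>w\<in>K (x t). norm (v - w) \<le> e / 2}"
    obtain d0 where d0: "d0 > 0" "\<And>z. z \<in> X \<inter> ball (x t) d0 \<Longrightarrow> F z \<subseteq> ?N"
      using field_usc[OF tX half_gt_zero[OF e]] by blast
    obtain d where d: "d > 0" "\<And>s. s \<in> {0..T} \<Longrightarrow> dist s t < d \<Longrightarrow> dist (x s) (x t) < d0 / 3"
      using x(1)[unfolded continuous_on_iff, rule_format, OF t, of "d0 / 3"] d0(1) by auto
    have "velocity_in x (K (x t)) e a b" if ab: "0 \<le> a" "a \<le> t" "t \<le> b" "b \<le> T" "b - a < d" for a b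
    proof (rule closed_velocity_in_limit[OF K_compact[OF tX], of a b "\<lambda>n. xs (k n)"])
      show "(\<lambda>n. xs (k n) s) \<longlonglongrightarrow> x s" if "s \<in> {a, b}" for s
        using that ab by (intro lim) auto
      have d03: "0 < d0 / 3"
        using d0(1) by simp
      have "\<forall>\<^sub>F n in sequentially. \<forall>s\<in>{0..T}. norm (xs (k n) s - x s) < d0 / 3"
        unfolding eventually_sequentially using x(3)[OF d03] by blast
      \<comment> \<open>Two demands on the tolerance: \<open>e / 2\<close> is what remains of the
        error after the thickening by \<open>e / 2\<close>, and the sampling radius must be below
        \<open>d0 / 3\<close>. The other two thirds go to uniform convergence and to the continuity
        of \<open>x\<close> at \<open>t\<close>.\<close>
      moreover have "\<forall>\<^sub>F n in sequentially. \<epsilon> (k n) < min (e / 2) (d0 / 3 / (M + 2))"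
        using \<epsilon>k e d0(1) M by (intro order_tendstoD) auto
      ultimately show "\<forall>\<^sub>F n in sequentially. velocity_in (xs (k n)) (K (x t)) e a b"
      proof eventually_elim
        case (elim n)
        have "(M + 2) * \<epsilon> (k n) < d0 / 3"
          using elim(2) M by (simp add: field_simps)
        have "euler_field B ((M + 2) * \<epsilon> (k n)) (xs (k n) s) \<subseteq> ?N" if s: "a \<le> s" "s \<le> b" for s
          unfolding euler_field_def
        proof (intro hull_minimal thickening_convex K_convex UN_least)
          fix c assume c: "c \<in> B \<inter> ball (xs (k n) s) ((M + 2) * \<epsilon> (k n))"
          have "dist (xs (k n) s) c < d0 / 3" "dist (xs (k n) s) (x s) < d0 / 3" "dist (x s) (x t) < d0 / 3"
            using c \<open>(M + 2) * \<epsilon> (k n) < d0 / 3\<close> elim(1) d(2)[of s] s ab by (auto simp: dist_norm)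
          then have "dist (x t) c < d0"
            by metric
          then show "F c \<subseteq> ?N"
            using c by (intro d0(2)) (auto simp: B_def)
        qed
        then have "velocity_in (xs (k n)) ?N (\<epsilon> (k n)) a b"
          using ab by (intro approx_sol_velocity_in[OF xs(2)] thickening_convex K_convex) auto
        then show ?case
          by (rule velocity_in_mono[where e' = "e / 2"]) (use ab elim(2) in auto)
      qed
    qed
    then show "\<exists>d>0. \<forall>a b. 0 \<le> a \<and> a \<le> t \<and> t \<le> b \<and> b \<le> T \<and> b - a < d \<longrightarrow> velocity_in x (K (x t)) e a b"
      using d(1) by blast
  qed
  then have "sol T x"
    using xB by (auto simp: sol_def B_def)
  then show ?thesis
    using T(1) x0 by blast
qed

section \<open>Inextensible solutions\<close>

lemma K_bounded_on_compact:
  assumes A: "compact A" "A \<subseteq> X"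
  shows "\<exists>M>0. \<forall>y\<in>A. K y \<subseteq> cball 0 M"
proof -
  have "\<exists>M e. M > 0 \<and> e > 0 \<and> (\<forall>z\<in>X \<inter> ball y e. K z \<subseteq> cball 0 M)" if y: "y \<in> A" for y
  proof -
    have yX: "y \<in> X"
      using y A(2) by blast
    obtain M where M: "M > 0" "\<And>w. w \<in> K y \<Longrightarrow> norm w \<le> M"
      using compact_imp_bounded[OF K_compact[OF yX]] unfolding bounded_pos by blast
    obtain e where e: "e > 0" "\<And>z v. z \<in> X \<inter> ball y e \<Longrightarrow> v \<in> K z \<Longrightarrow> \<exists>w\<in>K y. norm (v - w) \<le> 1"
      using K_usc[OF yX zero_less_one] by blast
    have "norm v \<le> M + 1" if zv: "z \<in> X \<inter> ball y e" "v \<in> K z" for z v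
    proof -
      obtain w where "w \<in> K y" "norm (v - w) \<le> 1"
        using e(2)[OF zv] by blast
      then show ?thesis
        using M(2)[of w] norm_triangle_sub[of v w] by linarith
    qed
    then show ?thesis
      using M(1) e(1) by (intro exI[of _ "M + 1"] exI[of _ e]) auto
  qed
  then have "\<forall>y\<in>A. \<exists>q. fst q > 0 \<and> snd q > 0 \<and> (\<forall>z\<in>X \<inter> ball y (snd q). K z \<subseteq> cball 0 (fst q))"
    by fastforce
  then obtain q where q: "\<forall>y\<in>A. fst (q y) > 0 \<and> snd (q y) > 0 \<and> (\<forall>z\<in>X \<inter> ball y (snd (q y)). K z \<subseteq> cball 0 (fst (q y)))"
    by (rule bchoice[THEN exE])
  define M e where "M = fst \<circ> q" and "e = snd \<circ> q"
  have Me: "\<And>y. y \<in> A \<Longrightarrow> M y > (0::real)" "\<And>y. y \<in> A \<Longrightarrow> e y > (0::real)"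
    "\<And>y z. y \<in> A \<Longrightarrow> z \<in> X \<inter> ball y (e y) \<Longrightarrow> K z \<subseteq> cball 0 (M y)"
    using q by (simp_all add: M_def e_def)
  have "A \<subseteq> (\<Union>y\<in>A. ball y (e y))"
    using Me(2) by force
  then obtain D where D: "D \<subseteq> A" "finite D" "A \<subseteq> (\<Union>y\<in>D. ball y (e y))"
    using compactE_image[OF A(1), of A "\<lambda>y. ball y (e y)"] by auto
  define N where "N = Max (insert 1 (M ` D))"
  have N: "1 \<le> N" "\<And>y. y \<in> D \<Longrightarrow> M y \<le> N"
    using D(2) by (auto simp: N_def)
  have "K z \<subseteq> cball 0 N" if zA: "z \<in> A" for z
  proof -
    obtain y where y: "y \<in> D" "z \<in> ball y (e y)"
      using D(3) zA by blast
    then have "K z \<subseteq> cball 0 (M y)"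
      using Me(3)[of y z] zA A(2) D(1) by blast
    then show ?thesis
      using subset_cball[OF N(2)[OF y(1)]] by (rule subset_trans)
  qed
  then show ?thesis
    using N(1) by (intro exI[of _ N]) auto
qed

lemma solD: "sol S x \<Longrightarrow> 0 \<le> t \<Longrightarrow> t \<le> S \<Longrightarrow> x t \<in> X"
  by (auto simp: sol_def)

lemma sol_velocity_in:
  assumes "sol S x" "0 \<le> t" "t \<le> S" "0 < e"
  shows "\<exists>d>0. \<forall>a b. 0 \<le> a \<and> a \<le> t \<and> t \<le> b \<and> b \<le> S \<and> b - a < d \<longrightarrow> velocity_in x (K (x t)) e a b"
proof -
  have "approx_sol K e x S"
    using assms by (simp add: sol_def)
  then show ?thesis
    using assms(2,3) by (simp add: approx_sol_def)
qed

lemma sol_restrict: "sol S x \<Longrightarrow> S' \<le> S \<Longrightarrow> sol S' x"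
  unfolding sol_def using approx_sol_restrict by fastforce

lemma sol_cong: "sol S x \<Longrightarrow> (\<And>t. 0 \<le> t \<Longrightarrow> t \<le> S \<Longrightarrow> x t = y t) \<Longrightarrow> sol S y"
  unfolding sol_def using approx_sol_cong[of K _ x S y] by (force simp: image_subset_iff)

lemma sol_concat:
  assumes "0 \<le> S" "sol S x" "sol h y" "y 0 = x S"
  shows "sol (S + h) (concat_at S x y)"
  unfolding sol_def
proof (intro conjI allI impI)
  show "concat_at S x y ` {0..S + h} \<subseteq> X"
    using assms(2,3) by (auto simp: concat_at_def sol_def image_subset_iff)
  fix e :: real assume "0 < e"
  then show "approx_sol K e (concat_at S x y) (S + h)"
    using assms by (intro approx_sol_concat K_convex) (simp_all add: sol_def)
qed

text \<open>At each \<open>t\<close> the compact set \<open>K (x t)\<close> bounds mean velocities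
  over short intervals around \<open>t\<close>. Continuity has to precede the Lipschitz bound, which
  needs the image to be compact.\<close>

lemma sol_continuous:
  assumes x: "sol S x"
  shows "continuous_on {0..S} x"
  unfolding continuous_on_iff
proof (intro ballI allI impI)
  fix t e assume t: "t \<in> {0..S}" and e: "0 < (e::real)"
  have tX: "x t \<in> X"
    using solD[OF x, of t] t by simp
  obtain M where M: "M > 0" "\<And>w. w \<in> K (x t) \<Longrightarrow> norm w \<le> M"
    using compact_imp_bounded[OF K_compact[OF tX]] unfolding bounded_pos by blast
  obtain d where d: "d > 0" "\<forall>a b. 0 \<le> a \<and> a \<le> t \<and> t \<le> b \<and> b \<le> S \<and> b - a < d \<longrightarrow> velocity_in x (K (x t)) 1 a b"
    using sol_velocity_in[OF x _ _ zero_less_one, of t] t by fastforce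
  have le: "norm (x b - x a) \<le> (M + 1) * (b - a)" if "0 \<le> a" "a \<le> t" "t \<le> b" "b \<le> S" "b - a < d" for a b
  proof (rule velocity_in_cball_imp_norm_le)
    have "velocity_in x (K (x t)) 1 a b"
      using that by (intro d(2)[rule_format]) simp
    moreover have "K (x t) \<subseteq> cball 0 M"
      using M(2) by auto
    ultimately show "velocity_in x (cball 0 M) 1 a b"
      by (rule velocity_in_subset)
  qed (use that in auto)
  have "dist (x s) (x t) < e" if s: "s \<in> {0..S}" "dist s t < min d (e / (M + 1))" for s
  proof -
    have "norm (x s - x t) \<le> (M + 1) * \<bar>s - t\<bar>"
    proof (cases "s \<le> t")
      case True
      then show ?thesis
        using le[of s t] s t by (simp add: dist_real_def norm_minus_commute)
    next
      case False
      then show ?thesis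
        using le[of t s] s t by (simp add: dist_real_def)
    qed
    also have "\<dots> < e"
      using s(2) M(1) by (simp add: dist_real_def field_simps)
    finally show ?thesis
      by (simp add: dist_norm)
  qed
  moreover have "min d (e / (M + 1)) > 0"
    using d(1) e M(1) by simp
  ultimately show "\<exists>d>0. \<forall>s\<in>{0..S}. dist s t < d \<longrightarrow> dist (x s) (x t) < e"
    by blast
qed

lemma sol_lipschitz:
  assumes x: "sol S x"
  shows "\<exists>C. C-lipschitz_on {0..S} x"
proof -
  have "compact (x ` {0..S})" "x ` {0..S} \<subseteq> X"
    using compact_continuous_image[OF sol_continuous[OF x]] x by (auto simp: sol_def)
  then obtain M where M: "M > 0" "\<And>t. t \<in> {0..S} \<Longrightarrow> K (x t) \<subseteq> cball 0 M"
    using K_bounded_on_compact by (metis imageI)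
  have "(M + 1)-lipschitz_on {0..S} x"
    by (rule approx_sol_lipschitz[of K]) (use x M in \<open>auto simp: sol_def\<close>)
  then show ?thesis
    by blast
qed

text \<open>Intervals ending at \<open>T\<close> are the new ones. Up to some \<open>s < T\<close>
  upper semicontinuity places the mean velocity near \<open>K (x T)\<close>; the remaining piece is
  made so short that it costs only a fraction of \<open>e * (T - a)\<close>.\<close>

lemma sol_extend_limit:
  assumes T: "0 < T" and x: "\<And>S. 0 \<le> S \<Longrightarrow> S < T \<Longrightarrow> sol S x"
    and X: "x T \<in> X" and lim: "(x \<longlongrightarrow> x T) (at T within {0..<T})"
  shows "sol T x"
  unfolding sol_def
proof (intro conjI allI impI)
  show "x ` {0..T} \<subseteq> X"
  proof
    fix y assume "y \<in> x ` {0..T}"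
    then obtain t where "y = x t" "0 \<le> t" "t \<le> T"
      by auto
    then show "y \<in> X"
      using solD[OF x, of t t] X by (cases "t = T") auto
  qed
  fix e :: real assume e: "0 < e"
  show "approx_sol K e x T"
    unfolding approx_sol_def
  proof
    fix t assume t: "t \<in> {0..T}"
    show "\<exists>d>0. \<forall>a b. 0 \<le> a \<and> a \<le> t \<and> t \<le> b \<and> b \<le> T \<and> b - a < d \<longrightarrow> velocity_in x (K (x t)) e a b"
    proof (cases "t = T")
      case False
      \<comment> \<open>A horizon strictly between \<open>t\<close> and \<open>T\<close>, since the
        solution property is given only before \<open>T\<close>; short intervals around
        \<open>t\<close> end before \<open>S\<close>.\<close>
      define S where "S = (t + T) / 2"
      have S: "t < S" "S < T" "0 \<le> S"
        using t False by (auto simp: S_def)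
      obtain d where d: "d > 0" "\<forall>a b. 0 \<le> a \<and> a \<le> t \<and> t \<le> b \<and> b \<le> S \<and> b - a < d \<longrightarrow> velocity_in x (K (x t)) e a b"
        using sol_velocity_in[OF x[OF S(3,2)], of t e] t S e by auto
      show ?thesis
      proof (intro exI[of _ "min d (S - t)"] conjI allI impI)
        fix a b assume "0 \<le> a \<and> a \<le> t \<and> t \<le> b \<and> b \<le> T \<and> b - a < min d (S - t)"
        then show "velocity_in x (K (x t)) e a b"
          by (intro d(2)[rule_format]) auto
      qed (use d S in auto)
    next
      case True
      have e4: "0 < e / 4"
        using e by simp
      have left_lim: "\<exists>d>0. \<forall>s. 0 \<le> s \<and> s < T \<and> T - s < d \<longrightarrow> dist (x s) (x T) < r" if "0 < r" for r
      proof -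
        obtain d where d: "d > 0" "\<forall>s\<in>{0..<T}. 0 < dist s T \<and> dist s T < d \<longrightarrow> dist (x s) (x T) < r"
          using lim[unfolded Lim_within, rule_format, OF \<open>0 < r\<close>] by blast
        have "dist (x s) (x T) < r" if "0 \<le> s" "s < T" "T - s < d" for s
          using that by (intro d(2)[rule_format]) (auto simp: dist_real_def)
        then show ?thesis
          using d(1) by blast
      qed
      obtain \<delta> where \<delta>: "\<delta> > 0" "\<And>z v. z \<in> X \<inter> ball (x T) \<delta> \<Longrightarrow> v \<in> K z \<Longrightarrow> \<exists>w\<in>K (x T). norm (v - w) \<le> e / 4"
        using K_usc[OF X e4] by blast
      let ?N = "{v. \<exists>w\<in>K (x T). norm (v - w) \<le> e / 4}"
      obtain d where d: "d > 0" "\<And>s. 0 \<le> s \<Longrightarrow> s < T \<Longrightarrow> T - s < d \<Longrightarrow> dist (x s) (x T) < \<delta>"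
        using left_lim[OF \<delta>(1)] by blast
      obtain M where M: "M > 0" "\<And>w. w \<in> K (x T) \<Longrightarrow> norm w \<le> M"
        using compact_imp_bounded[OF K_compact[OF X]] unfolding bounded_pos by blast
      have "velocity_in x (K (x T)) e a T" if a: "0 \<le> a" "a < T" "T - a < d" for a
      proof -
        \<comment> \<open>Budget: \<open>e / 2\<close> for the mean velocity up to \<open>s\<close>,
          and \<open>\<eta>\<close> for each of \<open>x T - x s\<close> and
          \<open>\<theta> *\<^sub>R w\<close>, together at most \<open>e * (T - a)\<close>. The last
          term is the origin of \<open>\<theta> < \<eta> / M\<close>.\<close>
        define \<eta> where "\<eta> = e / 4 * (T - a)"
        have \<eta>: "\<eta> > 0"
          using a e by (simp add: \<eta>_def)
        obtain d' where d': "d' > 0" "\<And>s. 0 \<le> s \<Longrightarrow> s < T \<Longrightarrow> T - s < d' \<Longrightarrow> dist (x s) (x T) < \<eta>"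
          using left_lim[OF \<eta>] by blast
        have "0 < min (min (T - a) d') (\<eta> / M)"
          using a d'(1) \<eta> M(1) by simp
        then obtain \<theta> where "0 < \<theta>" "\<theta> < min (min (T - a) d') (\<eta> / M)"
          using dense by blast
        then have \<theta>: "0 < \<theta>" "\<theta> < T - a" "\<theta> < d'" "\<theta> < \<eta> / M"
          by simp_all
        define s where "s = T - \<theta>"
        have s: "a < s" "s < T"
          using \<theta> by (auto simp: s_def)
        have "velocity_in x ?N (e / 4) a s"
        proof (rule approx_sol_velocity_in[where S = s])
          show "approx_sol K (e / 4) x s"
            using x[of s] a s e by (simp add: sol_def)
          show "convex ?N"
            by (intro thickening_convex K_convex)
          fix t assume t: "a \<le> t" "t \<le> s"
          then have "x t \<in> X \<inter> ball (x T) \<delta>"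
            using d(2)[of t] solD[OF x, of s t] a s by (simp add: dist_commute)
          then show "K (x t) \<subseteq> ?N"
            using \<delta>(2) by blast
        qed (use a s in auto)
        then have "velocity_in x (K (x T)) (e / 2) a s"
          by (rule velocity_in_mono[where e' = "e / 4"]) (use s in auto)
        then obtain w where w: "w \<in> K (x T)" "norm (x s - x a - (s - a) *\<^sub>R w) \<le> e / 2 * (s - a)"
          unfolding velocity_in_def by blast
        have 1: "norm (x T - x s) \<le> \<eta>"
          using d'(2)[of s] a s \<theta> by (simp add: dist_norm norm_minus_commute s_def)
        have 2: "norm (\<theta> *\<^sub>R w) \<le> \<eta>"
          using mult_mono[of \<theta> "\<eta> / M" "norm w" M] M w(1) \<theta> \<eta> by simp
        have eq: "x T - x a - (T - a) *\<^sub>R w = (x s - x a - (s - a) *\<^sub>R w) + ((x T - x s) - \<theta> *\<^sub>R w)"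
          by (simp add: s_def algebra_simps)
        have "norm (x T - x s - \<theta> *\<^sub>R w) \<le> \<eta> + \<eta>"
          using norm_triangle_ineq4[of "x T - x s" "\<theta> *\<^sub>R w"] 1 2 by linarith
        then have "norm (x T - x a - (T - a) *\<^sub>R w) \<le> e / 2 * (s - a) + (\<eta> + \<eta>)"
          unfolding eq by (rule norm_triangle_mono[OF w(2)])
        also have "\<dots> \<le> e / 2 * (T - a) + (\<eta> + \<eta>)"
          using e s by (intro add_right_mono mult_left_mono) auto
        also have "\<dots> = e * (T - a)"
          by (simp add: \<eta>_def field_simps)
        finally show ?thesis
          unfolding velocity_in_def using w(1) by blast
      qed
      moreover have "velocity_in x (K (x T)) e T T"
        using K_nonempty[OF X] by (auto simp: velocity_in_def)
      ultimately have "velocity_in x (K (x t)) e a b"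
        if "0 \<le> a \<and> a \<le> t \<and> t \<le> b \<and> b \<le> T \<and> b - a < d" for a b
        using that True by (cases "a = T") auto
      then show ?thesis
        using d(1) by blast
    qed
  qed
qed

text \<open>Dependent choice of ever longer solutions takes the place of a maximality principle: a
  curve reaching beyond the supremum \<open>T\<close> would have forced a longer step at some stage.
  Whether \<open>x\<close> has a limit at \<open>T\<close> is left open here.\<close>

lemma maximal_solution:
  assumes p: "p \<in> X"
  obtains (global) x where "x 0 = p" "\<And>S. 0 \<le> S \<Longrightarrow> sol S x"
  | (maximal) x T where "x 0 = p" "0 < T" "\<And>S. 0 \<le> S \<Longrightarrow> S < T \<Longrightarrow> sol S x"
    "\<And>S y. T < S \<Longrightarrow> sol S y \<Longrightarrow> \<exists>t\<in>{0..<T}. y t \<noteq> x t"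
proof -
  \<comment> \<open>Each step extends the solution by at least half of the possible gain in time, capped at 1
    so that the supremum is finite.\<close>
  define ext where "ext u w \<longleftrightarrow> fst u \<le> fst w \<and> sol (fst w) (snd w) \<and> (\<forall>t\<in>{0..fst u}. snd w t = snd u t)"
    for u w :: "real \<times> (real \<Rightarrow> 'a)"
  define P where "P u \<longleftrightarrow> 0 < fst u \<and> snd u 0 = p \<and> sol (fst u) (snd u)" for u :: "real \<times> (real \<Rightarrow> 'a)"
  define Q where "Q u w \<longleftrightarrow> ext u w \<and> (\<forall>w'. ext u w' \<longrightarrow> min 1 (fst w' - fst u) \<le> 2 * (fst w - fst u))"
    for u w :: "real \<times> (real \<Rightarrow> 'a)"
  have step: "\<exists>w. P w \<and> Q u w" if u: "P u" for u
  proof -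
    let ?A = "{min 1 (fst w - fst u) |w. ext u w}"
    have uu: "ext u u"
      using u by (simp add: ext_def P_def)
    define s where "s = Sup ?A"
    have bdd: "bdd_above ?A"
      by (intro bdd_aboveI[of _ 1]) auto
    have sup: "min 1 (fst w - fst u) \<le> s" if "ext u w" for w
      unfolding s_def using that by (intro cSup_upper bdd) blast
    have P: "P w" if "ext u w" for w
      using that u by (auto simp: ext_def P_def)
    show ?thesis
    proof (cases "s > 0")
      case True
      then have "s / 2 < Sup ?A"
        by (simp add: s_def)
      moreover have "?A \<noteq> {}"
        using uu by blast
      ultimately obtain a where "a \<in> ?A" "s / 2 < a"
        using less_cSupD by meson
      then obtain w where w: "ext u w" "s / 2 < min 1 (fst w - fst u)"
        by blast
      have "min 1 (fst w' - fst u) \<le> 2 * (fst w - fst u)" if "ext u w'" for w'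
        using sup[OF that] w(2) min.cobounded2[of 1 "fst w - fst u"] by argo
      then show ?thesis
        using w(1) P[OF w(1)] unfolding Q_def by blast
    next
      case False
      then have "min 1 (fst w - fst u) \<le> 2 * (fst u - fst u)" if "ext u w" for w
        using order_trans[OF sup[OF that], of 0] by simp
      then show ?thesis
        using uu u unfolding Q_def by blast
    qed
  qed
  obtain T0 x0 where "T0 > 0" "x0 0 = p" "sol T0 x0"
    using local_existence[OF p] by blast
  then have "\<exists>u. P u"
    by (auto simp: P_def intro!: exI[of _ "(T0, x0)"])
  then obtain f where f: "\<And>n. P (f n)" "\<And>n. Q (f n) (f (Suc n))"
    using dependent_nat_choice[of "\<lambda>_. P" "\<lambda>_. Q", OF _ step] by blast
  define S where "S n = fst (f n)" for n
  define Y where "Y n = snd (f n)" for n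
  have S0: "0 < S n" and Y0: "Y n 0 = p" and solY: "sol (S n) (Y n)" for n
    using f(1)[of n] by (auto simp: P_def S_def Y_def)
  \<comment> \<open>Every stage can be prolonged at its end point by local existence, so the choice
    rule forces a positive gain; hence all \<open>S n\<close> lie strictly below their supremum, if
    there is one.\<close>
  have S_less: "S n < S (Suc n)" for n
  proof -
    have "Y n (S n) \<in> X"
      using solD[OF solY] S0[of n] by (simp add: less_imp_le)
    then obtain h y where h: "h > 0" "y 0 = Y n (S n)" "sol h y"
      using local_existence by blast
    have "ext (f n) (S n + h, concat_at (S n) (Y n) y)"
      using sol_concat[OF _ solY h(3,2)] S0[of n] h(1)
      by (auto simp: ext_def S_def Y_def concat_at_def)
    then have le: "min 1 (S n + h - S n) \<le> 2 * (S (Suc n) - S n)"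
      using f(2)[of n] unfolding Q_def S_def by fastforce
    have "0 < min 1 (S n + h - S n)"
      using h(1) by simp
    then have "0 < 2 * (S (Suc n) - S n)"
      using le by (rule less_le_trans)
    then show ?thesis
      by simp
  qed
  then have S_mono: "strict_mono S"
    by (simp add: strict_mono_Suc_iff)
  have Y_Suc: "Y (Suc n) t = Y n t" if "0 \<le> t" "t \<le> S n" for n t
    using f(2)[of n] that by (auto simp: Q_def ext_def S_def Y_def)
  have Y_le: "Y m t = Y n t" if "n \<le> m" "0 \<le> t" "t \<le> S n" for n m t
    using that(1)
  proof (induction m rule: dec_induct)
    case (step m)
    have "t \<le> S m"
      using that(3) step(1) S_mono by (meson order_trans strict_mono_less_eq)
    then show ?case
      using step Y_Suc[of t m] that by simp
  qed simp
  \<comment> \<open>All stages covering \<open>t\<close> agree there; \<open>LEAST\<close> merely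
    picks one.\<close>
  define x where "x t = Y (LEAST n. t \<le> S n) t" for t
  have x_eq: "x t = Y n t" if "0 \<le> t" "t \<le> S n" for n t
  proof -
    have "t \<le> S (LEAST n. t \<le> S n)" "(LEAST n. t \<le> S n) \<le> n"
      using that(2) by (auto intro: LeastI Least_le)
    then show ?thesis
      unfolding x_def using Y_le[of "LEAST n. t \<le> S n" n t] that by simp
  qed
  have solx: "sol (S n) x" for n
    by (rule sol_cong[OF solY[of n]]) (simp add: x_eq)
  have x0: "x 0 = p"
    using x_eq[of 0 0] S0[of 0] Y0 by simp
  show thesis
  proof (cases "bdd_above (range S)")
    case False
    have "sol R x" if "0 \<le> R" for R
    proof -
      have "\<exists>n. R \<le> S n"
      proof (rule ccontr)
        assume "\<not> ?thesis"
        then have "bdd_above (range S)"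
          by (intro bdd_aboveI[of _ R]) (auto simp: not_le less_imp_le)
        with False show False ..
      qed
      then show ?thesis
        using sol_restrict[OF solx] by blast
    qed
    then show thesis
      using global x0 by blast
  next
    case True
    define T where "T = Sup (range S)"
    have ST: "S n < T" for n
      using S_less[of n] cSup_upper[OF rangeI True, of "Suc n"] by (simp add: T_def)
    have near: "\<exists>n. R < S n" if "R < T" for R
      using that less_cSupD[of "range S" R] by (auto simp: T_def)
    show thesis
    proof (rule maximal[of x T])
      show "0 < T"
        using ST[of 0] S0[of 0] by linarith
      show "sol R x" if R: "0 \<le> R" "R < T" for R
      proof -
        obtain n where "R < S n"
          using near R(2) by blast
        then show ?thesis
          using sol_restrict[OF solx, of R n] by simp
      qed
      fix R y assume R: "T < R" and y: "sol R y"
      show "\<exists>t\<in>{0..<T}. y t \<noteq> x t"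
      proof (rule ccontr)
        assume "\<not> ?thesis"
        then have eq: "y t = x t" if "0 \<le> t" "t < T" for t
          using that by auto
        \<comment> \<open>At every stage \<open>(R, y)\<close> offers a gain of at least
          \<open>c\<close>, so the step taken gains at least \<open>c / 2\<close>. From a stage
          within \<open>c / 4\<close> of \<open>T\<close> it would overshoot
          \<open>T\<close>.\<close>
        define c where "c = min 1 (R - T)"
        have c: "0 < c"
          using R by (simp add: c_def)
        obtain n where n: "T - c / 4 < S n"
          using near[of "T - c / 4"] c by auto
        have "ext (f n) (R, y)"
          using y R ST[of n] eq x_eq[of _ n] by (auto simp: ext_def S_def Y_def)
        then have le: "min 1 (R - S n) \<le> 2 * (S (Suc n) - S n)"
          using f(2)[of n] unfolding Q_def S_def by fastforce
        have "c \<le> min 1 (R - S n)"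
          using ST[of n] by (auto simp: c_def)
        then have "c \<le> 2 * (S (Suc n) - S n)"
          using le by (rule order_trans)
        then show False
          using n c ST[of "Suc n"] by argo
      qed
    qed (rule x0)
  qed
qed

section \<open>Krasovskii solutions\<close>

text \<open>The derivative is approximated by mean velocities from \<open>t\<close> to
  \<open>t + h\<close>, and these come arbitrarily close to the closed set \<open>K (x t)\<close>;
  \<open>t < S\<close> leaves room for \<open>h\<close>.\<close>

lemma sol_vector_derivative_in_K:
  assumes x: "sol S x" and t: "0 \<le> t" "t < S" and v: "(x has_vector_derivative v) (at t)"
  shows "v \<in> K (x t)"
proof -
  have "v \<in> closure (K (x t))"
    unfolding closure_approachable
  proof (intro allI impI)
    fix e :: real assume e: "0 < e"
    then have e3: "0 < e / 3"
      by simp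
    obtain d1 where d1: "d1 > 0" "\<forall>a b. 0 \<le> a \<and> a \<le> t \<and> t \<le> b \<and> b \<le> S \<and> b - a < d1 \<longrightarrow>
        velocity_in x (K (x t)) (e / 3) a b"
      using sol_velocity_in[OF x t(1) less_imp_le[OF t(2)] e3] by blast
    obtain d2 where d2: "d2 > 0" "\<forall>y. norm (y - t) < d2 \<longrightarrow>
        norm (x y - x t - (y - t) *\<^sub>R v) \<le> e / 3 * norm (y - t)"
      using v e3 unfolding has_vector_derivative_def has_derivative_at_alt by blast
    have "0 < min (min d1 d2) (S - t)"
      using d1(1) d2(1) t(2) by simp
    then obtain h where "0 < h" "h < min (min d1 d2) (S - t)"
      using dense by blast
    then have h: "0 < h" "h < d1" "h < d2" "t + h \<le> S"
      by simp_all
    have "velocity_in x (K (x t)) (e / 3) t (t + h)"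
      using h t(1) by (intro d1(2)[rule_format]) simp
    then obtain w where w: "w \<in> K (x t)" "norm (x (t + h) - x t - h *\<^sub>R w) \<le> e / 3 * h"
      unfolding velocity_in_def by auto
    have "norm (x (t + h) - x t - h *\<^sub>R v) \<le> e / 3 * h"
      using d2(2)[rule_format, of "t + h"] h by simp
    then have "norm ((x (t + h) - x t - h *\<^sub>R v) - (x (t + h) - x t - h *\<^sub>R w)) \<le> e / 3 * h + e / 3 * h"
      using norm_triangle_ineq4[of "x (t + h) - x t - h *\<^sub>R v" "x (t + h) - x t - h *\<^sub>R w"] w(2) by simp
    then have "norm (h *\<^sub>R (w - v)) \<le> h * (2 * (e / 3))"
      by (simp add: scaleR_diff_right algebra_simps)
    then have "norm (w - v) \<le> 2 * (e / 3)"
      using h(1) by simp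
    then have "dist w v < e"
      using e by (simp add: dist_norm)
    then show "\<exists>w\<in>K (x t). dist w v < e"
      using w(1) by blast
  qed
  moreover have "closed (K (x t))"
    by (simp add: krasovskii_def)
  ultimately show ?thesis
    by simp
qed

lemma sol_imp_krasovskii_solution:
  assumes S: "0 < S" and x: "sol S x"
  shows "krasovskii_solution X F (x 0) S x \<and> (\<exists>C. C-lipschitz_on {0..<S} x)"
proof -
  obtain C where C: "C-lipschitz_on {0..S} x"
    using sol_lipschitz[OF x] by blast
  have C': "C-lipschitz_on {0..<S} x"
    using C by (rule lipschitz_on_subset) auto
  \<comment> \<open>\<open>Rademacher_curve\<close> speaks of curves on the whole line. Freezing
    \<open>x\<close> outside \<open>{0..S}\<close> keeps the constant \<open>C\<close> and changes
    nothing near interior times; \<open>t = 0\<close> joins the exceptional set.\<close>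
  define y where "y t = x (max 0 (min S t))" for t
  have "C-lipschitz_on UNIV y"
  proof (rule lipschitz_onI)
    show "0 \<le> C"
      using lipschitz_on_nonneg[OF C] .
    fix s t :: real
    have "dist (y s) (y t) \<le> C * dist (max 0 (min S s)) (max 0 (min S t))"
      unfolding y_def using S by (intro lipschitz_onD[OF C]) auto
    also have "\<dots> \<le> C * dist s t"
      using \<open>0 \<le> C\<close> by (intro mult_left_mono) (auto simp: dist_real_def min_def max_def)
    finally show "dist (y s) (y t) \<le> C * dist s t" .
  qed
  then have neg: "negligible ({t. \<not> y differentiable (at t)} \<union> {0})"
    by (intro negligible_Un Rademacher_curve) auto
  have der: "\<exists>v\<in>K (x t). (x has_vector_derivative v) (at t within {0..<S})"
    if t: "0 < t" "t < S" "y differentiable (at t)" for t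
  proof -
    obtain v where "(y has_vector_derivative v) (at t)"
      using t(3) vector_derivative_works by blast
    then have "(x has_vector_derivative v) (at t)"
      by (rule has_vector_derivative_transform_within_open[where S = "{0<..<S}"])
        (use t in \<open>auto simp: y_def\<close>)
    then show ?thesis
      using sol_vector_derivative_in_K[OF x _ t(2)] t(1) has_vector_derivative_at_within
      by (metis less_imp_le)
  qed
  have "AE t\<in>{0..<S} in lebesgue. \<exists>v\<in>K (x t). (x has_vector_derivative v) (at t within {0..<S})"
  proof (rule AE_I')
    show "{t. \<not> y differentiable (at t)} \<union> {0} \<in> null_sets lebesgue"
      using neg by (simp add: negligible_iff_null_sets)
    show "{t \<in> space lebesgue. \<not> (t \<in> {0..<S} \<longrightarrow> (\<exists>v\<in>K (x t). (x has_vector_derivative v) (at t within {0..<S})))}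
      \<subseteq> {t. \<not> y differentiable (at t)} \<union> {0}"
    proof
      fix t assume t: "t \<in> {t \<in> space lebesgue. \<not> (t \<in> {0..<S} \<longrightarrow>
        (\<exists>v\<in>K (x t). (x has_vector_derivative v) (at t within {0..<S})))}"
      then have "t < S" "t = 0 \<or> 0 < t"
        by auto
      then show "t \<in> {t. \<not> y differentiable (at t)} \<union> {0}"
        using der[of t] t by blast
    qed
  qed
  moreover have "x ` {0..<S} \<subseteq> X"
    using x by (auto simp: sol_def)
  ultimately show ?thesis
    unfolding krasovskii_solution_def
    using S C' lipschitz_imp_absolutely_continuous[OF C'] by blast
qed

text \<open>
  The speed is at most L only while the curve is in the ball, so what is propagated from a to b
  is the implication between the bounds at a and at b; around points outside the ball it holds
  vacuously.
\<close>
lemma sol_stays_in_ball: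
  assumes x: "sol S x" "x 0 = p" and S: "0 \<le> S" and L: "0 \<le> L"
    and bnd: "\<And>y. y \<in> X \<Longrightarrow> norm (y - p) \<le> r \<Longrightarrow> K y \<subseteq> cball 0 L"
    and small: "L * S < r" and t: "0 \<le> t" "t \<le> S"
  shows "norm (x t - p) \<le> r"
proof -
  \<comment> \<open>Chosen to give \<open>(L + e) * S \<le> r\<close>: the strict inequality
    \<open>L * S < r\<close> leaves room for the error in the mean velocities, and
    \<open>S + 1\<close> avoids division by 0.\<close>
  define e where "e = (r - L * S) / (S + 1)"
  have e: "0 < e"
    using small S by (simp add: e_def)
  have "e * S \<le> e * (S + 1)"
    using e by (intro mult_left_mono) auto
  also have "\<dots> = r - L * S"
    using S by (simp add: e_def)
  finally have eS: "(L + e) * S \<le> r"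
    by (simp add: algebra_simps)
  have "(0::real) \<le> 0 \<and> t \<le> S \<longrightarrow> norm (x 0 - p) \<le> (L + e) * 0 \<longrightarrow> norm (x t - p) \<le> (L + e) * t"
    using t(1)
  proof (induction rule: Bolzano[where P = "\<lambda>a b. 0 \<le> a \<and> b \<le> S \<longrightarrow>
        norm (x a - p) \<le> (L + e) * a \<longrightarrow> norm (x b - p) \<le> (L + e) * b" and a = 0 and b = t])
    case (trans a b c)
    then show ?case
      by simp
  next
    case (local s)
    then have s: "0 \<le> s" "s \<le> S"
      using t by auto
    have sX: "x s \<in> X"
      using solD[OF x(1) s] .
    show ?case
    proof (cases "norm (x s - p) \<le> r")
      case True
      obtain d where d: "d > 0" "\<forall>a b. 0 \<le> a \<and> a \<le> s \<and> s \<le> b \<and> b \<le> S \<and> b - a < d \<longrightarrow>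
          velocity_in x (K (x s)) e a b"
        using sol_velocity_in[OF x(1) s e] by blast
      have "norm (x b - p) \<le> (L + e) * b"
        if ab: "a \<le> s" "s \<le> b" "b - a < d" "0 \<le> a" "b \<le> S" and a: "norm (x a - p) \<le> (L + e) * a" for a b
      proof -
        have "velocity_in x (K (x s)) e a b"
          using ab by (intro d(2)[rule_format]) simp
        then have "velocity_in x (cball 0 L) e a b"
          using bnd[OF sX True] by (rule velocity_in_subset)
        then have "norm (x b - x a) \<le> (L + e) * (b - a)"
          using ab by (intro velocity_in_cball_imp_norm_le) auto
        then show ?thesis
          using norm_triangle_mono[OF _ a] by (fastforce simp: algebra_simps)
      qed
      then show ?thesis
        using d(1) by blast
    next
      case False
      obtain d where d: "d > 0" "\<forall>a\<in>{0..S}. dist a s < d \<longrightarrow> dist (x a) (x s) < norm (x s - p) - r"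
        using sol_continuous[OF x(1), unfolded continuous_on_iff, rule_format, of s "norm (x s - p) - r"] s False
        by auto
      have "\<not> norm (x a - p) \<le> (L + e) * a" if ab: "a \<le> s" "s - a < d" "0 \<le> a" for a
      proof
        assume a: "norm (x a - p) \<le> (L + e) * a"
        have "(L + e) * a \<le> (L + e) * S"
          using ab s L e by (intro mult_left_mono) auto
        then have "norm (x a - p) \<le> r"
          using a eS by linarith
        moreover have "dist (x a) (x s) < norm (x s - p) - r"
          using ab s by (intro d(2)[rule_format]) (auto simp: dist_real_def)
        ultimately show False
          using norm_triangle_ineq[of "x s - x a" "x a - p"] by (simp add: dist_norm norm_minus_commute)
      qed
      then show ?thesis
        using d(1) by (intro exI[of _ d]) auto
    qed
  qed
  then have "norm (x t - p) \<le> (L + e) * t"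
    using t x(2) by simp
  also have "\<dots> \<le> (L + e) * S"
    using t L e by (intro mult_left_mono) auto
  finally show ?thesis
    using eS by linarith
qed

text \<open>The product form includes \<open>L = 0\<close>, where it contradicts
  \<open>0 < r\<close> and so rules out a finite lifetime.\<close>

lemma maximal_time_gt:
  assumes T: "0 < T" and x0: "x 0 = p" and sol: "\<And>S. 0 \<le> S \<Longrightarrow> S < T \<Longrightarrow> sol S x"
    and max: "\<And>S y. T < S \<Longrightarrow> sol S y \<Longrightarrow> \<exists>t\<in>{0..<T}. y t \<noteq> x t"
    and r: "0 < r" and cl: "closed {y \<in> X. norm (y - p) \<le> r}" and L: "0 \<le> L"
    and bnd: "\<And>y. y \<in> X \<Longrightarrow> norm (y - p) \<le> r \<Longrightarrow> K y \<subseteq> cball 0 L"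
  shows "r < L * T"
proof (rule ccontr)
  assume "\<not> r < L * T"
  then have LT: "L * T \<le> r"
    by simp
  have small: "L * S < r" if "S < T" for S
  proof (cases "L = 0")
    case False
    then have "L * S < L * T"
      using L that by simp
    then show ?thesis
      using LT by linarith
  qed (use r in simp)
  have inU: "norm (x t - p) \<le> r" if "0 \<le> t" "t < T" for t
    by (rule sol_stays_in_ball[OF sol[OF that] x0 that(1) L bnd small[OF that(2)] that(1)]) auto
  \<comment> \<open>Error 1 is enough: the bound only serves to make \<open>x\<close> uniformly
    continuous, so that it has a limit at \<open>T\<close>.\<close>
  have "(L + 1)-lipschitz_on {0..<T} x"
  proof (rule lipschitz_onI)
    fix s t assume st: "s \<in> {0..<T}" "t \<in> {0..<T}"
    define S where "S = max s t"
    have S: "0 \<le> S" "S < T"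
      using st by (auto simp: S_def)
    have "(L + 1)-lipschitz_on {0..S} x"
    proof (rule approx_sol_lipschitz[of K])
      show "approx_sol K 1 x S"
        using sol[OF S] by (simp add: sol_def)
      show "K (x u) \<subseteq> cball 0 L" if "u \<in> {0..S}" for u
        using that S inU solD[OF sol[OF S]] by (intro bnd) auto
    qed (use L in simp)
    then show "dist (x s) (x t) \<le> (L + 1) * dist s t"
      using st by (intro lipschitz_onD) (auto simp: S_def)
  qed (use L in simp)
  moreover have "T \<in> closure {0..<T}"
    using T by simp
  ultimately obtain l where l: "(x \<longlongrightarrow> l) (at T within {0..<T})"
    using uniformly_continuous_on_extension_at_closure[OF lipschitz_on_uniformly_continuous] by blast
  have "l \<in> {y \<in> X. norm (y - p) \<le> r}"
  proof (rule Lim_in_closed_set[OF cl _ _ l])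
    show "\<forall>\<^sub>F t in at T within {0..<T}. x t \<in> {y \<in> X. norm (y - p) \<le> r}"
      unfolding eventually_at_filter
    proof (intro always_eventually allI impI)
      fix t assume "t \<in> {0..<T}"
      then show "x t \<in> {y \<in> X. norm (y - p) \<le> r}"
        using inU[of t] solD[OF sol, of t t] by simp
    qed
    show "at T within {0..<T} \<noteq> bot"
      using T by (simp add: trivial_limit_within islimpt_Ico)
  qed
  then have lX: "l \<in> X"
    by simp
  \<comment> \<open>The value of \<open>x\<close> at \<open>T\<close> is arbitrary so far; it is
    replaced by the limit.\<close>
  define x' where "x' = x(T := l)"
  have eq: "x' t = x t" if "t < T" for t
    using that by (simp add: x'_def)
  have "sol T x'"
  proof (rule sol_extend_limit[OF T])
    show "sol S x'" if "0 \<le> S" "S < T" for S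
      using sol_cong[OF sol[OF that]] eq that by simp
    show "x' T \<in> X"
      using lX by (simp add: x'_def)
    have "(x' \<longlongrightarrow> l) (at T within {0..<T})"
      by (rule Lim_transform_eventually[OF l]) (simp add: eventually_at_filter eq)
    then show "(x' \<longlongrightarrow> x' T) (at T within {0..<T})"
      by (simp add: x'_def)
  qed
  obtain h y where h: "h > 0" "y 0 = l" "sol h y"
    using local_existence[OF lX] by blast
  have "sol (T + h) (concat_at T x' y)"
    using T h(2) by (intro sol_concat \<open>sol T x'\<close> h(3)) (simp_all add: x'_def)
  then have "\<exists>t\<in>{0..<T}. concat_at T x' y t \<noteq> x t"
    using h(1) by (intro max) simp_all
  then obtain t where "t \<in> {0..<T}" "concat_at T x' y t \<noteq> x t" ..
  then show False
    by (simp add: concat_at_def eq)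
qed

text \<open>In HOL \<open>r / 0 = 0\<close>, so for \<open>L = 0\<close> the then infinite lifetime
  has to be expressed separately. The sets \<open>K y\<close> are nonempty, which makes a maximum
  \<open>L\<close> nonnegative.\<close>

theorem krasovskii_existence:
  assumes p: "p \<in> X"
  shows "\<exists>x. (\<exists>T>0. krasovskii_solution X F p T x) \<and>
    (\<forall>r>0. \<forall>L :: real.
       closed {y \<in> X. norm (y - p) \<le> r} \<and>
       is_max_on {y \<in> X. norm (y - p) \<le> r} (\<lambda>y. set_norm (K y)) L \<longrightarrow>
       (if L = 0
        then \<forall>T>0. krasovskii_solution X F p T x \<and> (\<exists>C. C-lipschitz_on {0..<T} x)
        else \<exists>T>r / L. krasovskii_solution X F p T x \<and> (\<exists>C. C-lipschitz_on {0..<T} x)))"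
proof -
  have L: "0 \<le> L \<and> (\<forall>y. y \<in> X \<and> norm (y - p) \<le> r \<longrightarrow> K y \<subseteq> cball 0 L)"
    if max: "is_max_on {y \<in> X. norm (y - p) \<le> r} (\<lambda>y. set_norm (K y)) L" for r L
  proof -
    have bnd: "K y \<subseteq> cball 0 L" if "y \<in> X" "norm (y - p) \<le> r" for y
    proof
      fix v assume "v \<in> K y"
      then have "ereal (norm v) \<le> set_norm (K y)"
        unfolding set_norm_def by (rule SUP_upper)
      also have "\<dots> \<le> ereal L"
        using max that by (simp add: is_max_on_def)
      finally show "v \<in> cball 0 L"
        by simp
    qed
    obtain y where y: "y \<in> X" "norm (y - p) \<le> r"
      using max by (auto simp: is_max_on_def)
    obtain v where "v \<in> K y"
      using K_nonempty[OF y(1)] by blast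
    then have "norm v \<le> L"
      using bnd[OF y] by auto
    then have "0 \<le> L"
      using norm_ge_zero[of v] by linarith
    then show ?thesis
      using bnd by blast
  qed
  from p show ?thesis
  proof (cases rule: maximal_solution)
    case (global x)
    have "krasovskii_solution X F p T x \<and> (\<exists>C. C-lipschitz_on {0..<T} x)" if "0 < T" for T
      using sol_imp_krasovskii_solution[OF that, of x] global that by simp
    moreover have "\<exists>T>0. r / L < T" for r L :: real
      by (intro exI[of _ "max (r / L) 0 + 1"]) auto
    ultimately show ?thesis
      by (intro exI[of _ x]) (auto split: if_split, meson, meson zero_less_one)
  next
    case (maximal x T)
    have good: "krasovskii_solution X F p S x \<and> (\<exists>C. C-lipschitz_on {0..<S} x)" if "0 < S" "S < T" for S
      using sol_imp_krasovskii_solution[OF that(1) maximal(3)] maximal(1) that by simp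
    have "if L = 0
        then \<forall>T>0. krasovskii_solution X F p T x \<and> (\<exists>C. C-lipschitz_on {0..<T} x)
        else \<exists>T>r / L. krasovskii_solution X F p T x \<and> (\<exists>C. C-lipschitz_on {0..<T} x)"
      if r: "0 < r" and cl: "closed {y \<in> X. norm (y - p) \<le> r}"
        and max: "is_max_on {y \<in> X. norm (y - p) \<le> r} (\<lambda>y. set_norm (K y)) L" for r L
    proof -
      have gt: "r < L * T"
        by (rule maximal_time_gt[of T x p r L]) (use maximal r cl L[OF max] in blast)+
      then have "0 < L"
        using r maximal(2) L[OF max] by (cases "L = 0") auto
      then have "0 < r / L" "r / L < T"
        using r gt by (simp_all add: field_simps)
      \<comment> \<open>A horizon below \<open>T\<close>, because the curve is known to be a
        solution only on intervals ending before \<open>T\<close>.\<close>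
      then obtain S where "r / L < S" "S < T" "0 < S"
        using dense[of "r / L" T] by (meson less_trans)
      then show ?thesis
        using good[of S] \<open>0 < L\<close> by auto
    qed
    moreover have "\<exists>S>0. krasovskii_solution X F p S x"
      using good[of "T / 2"] maximal(2) by (intro exI[of _ "T / 2"]) simp
    ultimately show ?thesis
      by blast
  qed
qed

end

section \<open>Projected vector fields as an instance of tangent fields\<close>

theorem theorem4p2:
  fixes X :: "(real ^ 'n) set"
    and f :: "real ^ 'n \<Rightarrow> real ^ 'n"
    and g :: "real ^ 'n \<Rightarrow> real ^ 'n \<Rightarrow> real ^ 'n \<Rightarrow> real"
    and x0 :: "real ^ 'n"
  assumes "locally_compact_set X"
    and "locally_bounded_on X f"
    and "metric_on X g"
    and "locally_weakly_bounded X g"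
    and "x0 \<in> X"
  shows "\<exists>x :: real \<Rightarrow> real ^ 'n.
    (\<exists>T>0. krasovskii_solution X (projected_field X g f) x0 T x) \<and>
    (\<forall>r>0. \<forall>L :: real.
       closed {y \<in> X. norm (y - x0) \<le> r} \<and>
       is_max_on {y \<in> X. norm (y - x0) \<le> r}
         (\<lambda>y. set_norm (krasovskii X (projected_field X g f) y)) L \<longrightarrow>
       (if L = 0
        then \<forall>T>0. krasovskii_solution X (projected_field X g f) x0 T x \<and>
                   (\<exists>C. C-lipschitz_on {0..<T} x)
        else \<exists>T>r / L. krasovskii_solution X (projected_field X g f) x0 T x \<and>
                       (\<exists>C. C-lipschitz_on {0..<T} x)))"
proof -
  have g: "is_inner_product (g y)" if "y \<in> X" for y
    using assms(3) that by (simp add: metric_on_def)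
  interpret tangent_field X "projected_field X g f"
  proof
    show "locally_compact_set X"
      by fact
    fix y assume y: "y \<in> X"
    show "projected_field X g f y \<noteq> {}"
      by (rule projected_field_nonempty[of g y X f, OF g[OF y] y])
    show "projected_field X g f y \<subseteq> tangent_cone X y"
      using projected_field_iff[of g y, OF g[OF y]] by blast
    show "\<exists>M>0. \<exists>e>0. \<forall>z\<in>X \<inter> ball y e. \<forall>v\<in>projected_field X g f z. norm v \<le> M"
      by (rule locally_bounded_projected_field[OF assms(2-4) y])
  qed
  show ?thesis
    by (rule krasovskii_existence[OF assms(5)])
qed

end
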